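(* Let $\mathfrak{F}$ be a non-empty hereditary formation of finite groups and let $\pi\subseteq\mathbb{P}$ be a set of primes. Then: (1) $\mathfrak{F}\subseteq \mathrm{w}^{*}\mathfrak{F}\subseteq \mathrm{w}^{*}_{\pi}\mathfrak{F}$; (2) $\mathrm{w}^{*}_{\pi}\mathfrak{F}$ is an $S_H$-closed formation; (3) $\mathrm{w}^{*}_{\pi}\mathfrak{F}=\mathrm{w}^{*}_{\pi}(\mathrm{w}^{*}_{\pi}\mathfrak{F})$.
   Context: All groups are finite; classes of groups are closed under isomorphism. $\mathbb{P}$ is the set of all primes. For a group $G$, $\pi(G)$ is the set of prime divisors of $|G|$; for a class of groups $\mathfrak{F}$, $\pi(\mathfrak{F})=\bigcup_{G\in\mathfrak{F}}\pi(G)$. A class $\mathfrak{F}$ is a formation if (i) $G\in\mathfrak{F}$ and $N\trianglelefteq G$ imply $G/N\in\mathfrak{F}$, and (ii) $N_1,N_2\trianglelefteq G$ with $G/N_1,G/N_2\in\mathfrak{F}$ imply $G/(N_1\cap N_2)\in\mathfrak{F}$. A formation is hereditary if it contains every subgroup of each of its members. For a non-empty formation $\mathfrak{F}$, the residual $G^{\mathfrak{F}}$ is the smallest normal subgroup of $G$ with $G/G^{\mathfrak{F}}\in\mathfrak{F}$. For a non-empty formation $\mathfrak{F}$, a subgroup $H\le G$ is $\mathfrak{F}$-subnormal in $G$ if either $H=G$ or there is a chain $H=H_0<H_1<\dots<H_n=G$ in which each $H_{i-1}$ is a maximal subgroup of $H_i$ and $H_i^{\mathfrak{F}}\le H_{i-1}$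 for $i=1,\dots,n$. For a non-empty formation $\mathfrak{F}$ and a set of primes $\pi$, $\mathrm{w}^{*}_{\pi}\mathfrak{F}$ is the class of all groups $G$ such that $\pi(G)\subseteq\pi(\mathfrak{F})$ and, for every $q\in\pi\cap\pi(G)$ and every Sylow $q$-subgroup $Q$ of $G$, the normalizer $N_G(Q)$ is $\mathfrak{F}$-subnormal in $G$. For $\pi=\mathbb{P}$ write $\mathrm{w}^{*}\mathfrak{F}=\mathrm{w}^{*}_{\mathbb{P}}\mathfrak{F}$. A class of groups is $S_H$-closed if it contains every Hall subgroup (subgroup whose order and index are coprime) of each of its members. *)

theory Defs
  imports "HOL-Algebra.Group_Action" "HOL-Computational_Algebra.Primes"
begin

text \<open>
  A class of finite groups is represented by its members whose carrier is a set of natural numbers.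
  This loses nothing: classes are closed under isomorphism and every finite group is isomorphic to
  one on a set of naturals (lemma \<open>finite_group_iso_nat\<close> below).  \<open>in_class\<close> extends
  membership to groups over other carrier types, such as quotients.
\<close>

type_synonym group_class = "nat monoid set"

definition group_class :: "group_class \<Rightarrow> bool" where
  "group_class F \<longleftrightarrow>
     (\<forall>G\<in>F. group G \<and> finite (carrier G)) \<and>
     (\<forall>G\<in>F. \<forall>H :: nat monoid. group H \<longrightarrow> G \<cong> H \<longrightarrow> H \<in> F)"

definition in_class :: "('a, 'b) monoid_scheme \<Rightarrow> group_class \<Rightarrow> bool" where
  "in_class G F \<longleftrightarrow> group G \<and> (\<exists>H\<in>F. G \<cong> H)"

lemma finite_group_iso_nat:
  assumes "group G" "finite (carrier G)"
  shows "\<exists>H :: nat monoid. group H \<and> G \<cong> H"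
proof -
  obtain h :: "_ \<Rightarrow> nat" where h: "inj_on h (carrier G)"
    using finite_imp_inj_to_nat_seg[OF assms(2)] by blast
  define g where "g = inv_into (carrier G) h"
  define H :: "nat monoid" where
    "H = \<lparr>carrier = h ` carrier G, monoid.mult = (\<lambda>x y. h (g x \<otimes>\<^bsub>G\<^esub> g y)), one = h \<one>\<^bsub>G\<^esub>\<rparr>"
  have "h \<in> iso G H"
    using h by (auto simp: H_def g_def iso_def hom_def bij_betw_def group.is_monoid[OF assms(1)]
      monoid.m_closed)
  moreover have "group (H \<lparr>one := h \<one>\<^bsub>G\<^esub>\<rparr>)"
    by (rule group.iso_imp_img_group[OF assms(1) calculation])
  ultimately show ?thesis
    by (auto simp: H_def is_iso_def)
qed

lemma in_class_iff_mem:
  fixes G :: "nat monoid"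
  assumes "group_class F" "group G"
  shows "in_class G F \<longleftrightarrow> G \<in> F"
  using assms group.iso_sym[OF assms(2)] iso_refl
  unfolding group_class_def in_class_def by blast

abbreviation all_primes :: "nat set" where
  "all_primes \<equiv> {p. prime p}"

definition group_primes :: "('a, 'b) monoid_scheme \<Rightarrow> nat set" where
  "group_primes G = {p. prime p \<and> p dvd order G}"

definition class_primes :: "group_class \<Rightarrow> nat set" where
  "class_primes F = (\<Union>G\<in>F. group_primes G)"

definition formation :: "group_class \<Rightarrow> bool" where
  "formation F \<longleftrightarrow> group_class F \<and>
     (\<forall>G\<in>F. \<forall>N. N \<lhd> G \<longrightarrow> in_class (G Mod N) F) \<and>
     (\<forall>(G :: nat monoid) N1 N2. group G \<longrightarrow> finite (carrier G) \<longrightarrow>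
        N1 \<lhd> G \<longrightarrow> N2 \<lhd> G \<longrightarrow> in_class (G Mod N1) F \<longrightarrow> in_class (G Mod N2) F \<longrightarrow>
        in_class (G Mod (N1 \<inter> N2)) F)"

definition hereditary :: "group_class \<Rightarrow> bool" where
  "hereditary F \<longleftrightarrow> (\<forall>G\<in>F. \<forall>H. subgroup H G \<longrightarrow> G\<lparr>carrier := H\<rparr> \<in> F)"

definition hall_subgroup :: "'a set \<Rightarrow> ('a, 'b) monoid_scheme \<Rightarrow> bool" where
  "hall_subgroup H G \<longleftrightarrow> subgroup H G \<and> coprime (card H) (card (rcosets\<^bsub>G\<^esub> H))"

definition S_H_closed :: "group_class \<Rightarrow> bool" where
  "S_H_closed F \<longleftrightarrow> (\<forall>G\<in>F. \<forall>H. hall_subgroup H G \<longrightarrow> G\<lparr>carrier := H\<rparr> \<in> F)"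

text \<open>
  The smallest element, with respect to inclusion, among the normal subgroups with quotient in
  \<open>F\<close>; it exists whenever \<open>G\<close> is finite and \<open>F\<close> is a non-empty formation.
\<close>

definition residual :: "('a, 'b) monoid_scheme \<Rightarrow> group_class \<Rightarrow> 'a set" where
  "residual G F = (LEAST R. R \<lhd> G \<and> in_class (G Mod R) F)"

definition maximal_subgroup :: "'a set \<Rightarrow> ('a, 'b) monoid_scheme \<Rightarrow> bool" where
  "maximal_subgroup M G \<longleftrightarrow> subgroup M G \<and> M \<noteq> carrier G \<and>
     (\<forall>K. subgroup K G \<longrightarrow> M \<subseteq> K \<longrightarrow> K = M \<or> K = carrier G)"

text \<open>A chain of length \<open>n = 0\<close> covers the case \<open>H = G\<close>.\<close>

definition subnormal_wrt :: "group_class \<Rightarrow> 'a set \<Rightarrow> ('a, 'b) monoid_scheme \<Rightarrow> bool" where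
  "subnormal_wrt F H G \<longleftrightarrow> subgroup H G \<and>
     (\<exists>(n :: nat) C. C 0 = H \<and> C n = carrier G \<and>
        (\<forall>i<n. maximal_subgroup (C i) (G\<lparr>carrier := C (Suc i)\<rparr>) \<and>
               residual (G\<lparr>carrier := C (Suc i)\<rparr>) F \<subseteq> C i))"

definition sylow_subgroup :: "nat \<Rightarrow> 'a set \<Rightarrow> ('a, 'b) monoid_scheme \<Rightarrow> bool" where
  "sylow_subgroup q Q G \<longleftrightarrow> subgroup Q G \<and> card Q = q ^ multiplicity q (order G)"

definition wstar :: "nat set \<Rightarrow> group_class \<Rightarrow> group_class" where
  "wstar \<pi> F = {G. group G \<and> finite (carrier G) \<and> group_primes G \<subseteq> class_primes F \<and>
     (\<forall>q \<in> \<pi> \<inter> group_primes G. \<forall>Q. sylow_subgroup q Q G \<longrightarrow> subnormal_wrt F (normalizer G Q) G)}"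

end

theory Submission
  imports Defs "HOL-Algebra.Sylow"
begin

text \<open>
  For hereditary \<open>F\<close>, a subgroup is \<open>F\<close>-subnormal iff it is joined to the group by a chain in which
  every term \<open>B\<close> has a homomorphism to a member of \<open>F\<close> whose kernel lies in the preceding term.
  In this form it is clear that \<open>F\<close>-subnormality passes to intersections with subgroups, to
  preimages, and (as \<open>F\<close> is closed under quotients) to homomorphic images. Surjections send Sylow
  subgroups to Sylow subgroups and, by the Frattini argument, normalizers of Sylow subgroups to
  normalizers, which gives closure of \<open>w\<^sup>*F\<close> under quotients.  For a subdirect
  product, \<open>N(Q)\<close> is the intersection of the preimages of the normalizers in the two factors.

  For the idempotency, follow a chain from \<open>N = N(Q)\<close> with respect to \<open>w\<^sup>*F\<close> upwards.  At a step
  \<open>B < C\<close> with residual \<open>R \<le> B\<close> of \<open>C\<close>, the subgroup \<open>M = N R\<close> is the preimage of the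
  normalizer of \<open>QR/R\<close>, so it is \<open>F\<close>-subnormal in \<open>C\<close>; it lies in \<open>B\<close>, and \<open>N\<close> is
  \<open>F\<close>-subnormal in \<open>B\<close> by induction, hence in \<open>M\<close>, hence in \<open>C\<close>.
\<close>

section \<open>Normalizers, conjugates and the action on right cosets\<close>

context group begin

text \<open>Conjugation by \<open>x\<close> is injective, so on the finite set \<open>Q\<close>
  mapping into \<open>Q\<close> already means mapping onto \<open>Q\<close>. The stabilizer
  condition thus becomes a pointwise one.\<close>

lemma mem_normalizer_iff:
  assumes "finite (carrier G)" "subgroup Q G"
  shows "x \<in> normalizer G Q \<longleftrightarrow> x \<in> carrier G \<and> (\<forall>q\<in>Q. x \<otimes> q \<otimes> inv x \<in> Q)"
proof -
  have sub: "Q \<subseteq> carrier G" and fin: "finite Q"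
    using assms subgroup.subset finite_subset by blast+
  have eq: "x <# Q #> inv x = (\<lambda>q. x \<otimes> q \<otimes> inv x) ` Q"
    by (auto simp: l_coset_def r_coset_def)
  have "inj_on (\<lambda>q. x \<otimes> q \<otimes> inv x) Q" if "x \<in> carrier G"
    using sub that by (intro inj_onI) (auto simp: subset_iff)
  then have "(\<lambda>q. x \<otimes> q \<otimes> inv x) ` Q = Q"
    if "x \<in> carrier G" "\<forall>q\<in>Q. x \<otimes> q \<otimes> inv x \<in> Q"
    using that fin by (intro card_subset_eq) (auto simp: card_image)
  then show ?thesis
    using sub by (auto simp: normalizer_def stabilizer_def eq)
qed

lemma subgroup_normalizer:
  assumes "subgroup Q G"
  shows "subgroup (normalizer G Q) G"
  using assms normalizer_imp_subgroup subgroup.subset by blast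

lemma subset_normalizer:
  assumes "finite (carrier G)" "subgroup Q G"
  shows "Q \<subseteq> normalizer G Q"
  using assms subgroup.subset[OF assms(2)]
  by (auto simp: mem_normalizer_iff subgroup.m_closed subgroup.m_inv_closed)

lemma normalizer_restrict:
  assumes "finite (carrier G)" "subgroup Q G" "subgroup H G" "Q \<subseteq> H"
  shows "normalizer (G\<lparr>carrier := H\<rparr>) Q = normalizer G Q \<inter> H"
proof -
  have sub: "H \<subseteq> carrier G" using assms(3) subgroup.subset by blast
  then have "finite (carrier (G\<lparr>carrier := H\<rparr>))"
    using assms(1) finite_subset by auto
  from group.mem_normalizer_iff[OF subgroup_imp_group[OF assms(3)] this subgroup_incl[OF assms(2-4)]]
  show ?thesis
    using assms sub by (auto simp: mem_normalizer_iff)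
qed

lemma conjugate_subgroup:
  assumes "subgroup P G" "g \<in> carrier G"
  shows "subgroup ((\<lambda>p. g \<otimes> p \<otimes> inv g) ` P) G"
    and "card ((\<lambda>p. g \<otimes> p \<otimes> inv g) ` P) = card P"
proof -
  have sub: "P \<subseteq> carrier G" using assms subgroup.subset by blast
  have "(\<lambda>p. g \<otimes> p \<otimes> inv g) \<in> hom G G"
  proof (rule homI)
    fix x y assume "x \<in> carrier G" "y \<in> carrier G"
    then have "inv g \<otimes> (g \<otimes> (y \<otimes> inv g)) = y \<otimes> inv g"
      using assms(2) by (simp add: m_assoc[symmetric])
    with \<open>x \<in> carrier G\<close> \<open>y \<in> carrier G\<close>
    show "g \<otimes> (x \<otimes> y) \<otimes> inv g = (g \<otimes> x \<otimes> inv g) \<otimes> (g \<otimes> y \<otimes> inv g)"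
      using assms(2) by (simp add: m_assoc)
  qed (use assms(2) in simp)
  then have "group_hom G G (\<lambda>p. g \<otimes> p \<otimes> inv g)"
    by (simp add: group_hom_def group_hom_axioms_def is_group)
  then show "subgroup ((\<lambda>p. g \<otimes> p \<otimes> inv g) ` P) G"
    using assms(1) group_hom.subgroup_img_is_subgroup by blast
  show "card ((\<lambda>p. g \<otimes> p \<otimes> inv g) ` P) = card P"
    using sub assms by (intro card_image inj_onI) (auto simp: subset_iff)
qed

text \<open>Inverting \<open>g\<close> turns multiplication on the right into a left action. The
  restricted abstraction is forced by \<open>Bij\<close>, whose elements are extensional.\<close>

lemma rcosets_action:
  assumes "subgroup P G"
  shows "group_action G (rcosets P) (\<lambda>g. \<lambda>X\<in>rcosets P. X #> inv g)"
proof -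
  have sub: "P \<subseteq> carrier G" using assms subgroup.subset by blast
  have X: "X #> x \<in> rcosets P" if "X \<in> rcosets P" "x \<in> carrier G" for X x
    using that sub by (auto simp: RCOSETS_def coset_mult_assoc)
  have XX: "X #> x #> y = X #> (x \<otimes> y)"
    if "X \<in> rcosets P" "x \<in> carrier G" "y \<in> carrier G" for X x y
    using that sub by (auto simp: RCOSETS_def coset_mult_assoc m_assoc)
  have X1: "X #> \<one> = X" if "X \<in> rcosets P" for X
    using that sub by (auto simp: RCOSETS_def coset_mult_assoc)
  have bij: "(\<lambda>X\<in>rcosets P. X #> inv g) \<in> Bij (rcosets P)" if "g \<in> carrier G" for g
  proof -
    have "bij_betw (\<lambda>X. X #> inv g) (rcosets P) (rcosets P)"
      by (rule bij_betwI[where g = "\<lambda>X. X #> g"]) (use that in \<open>auto simp: X XX X1\<close>)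
    then show ?thesis by (auto simp: Bij_def cong: bij_betw_cong)
  qed
  show ?thesis
    unfolding group_action_def group_hom_def group_hom_axioms_def
  proof (intro conjI is_group group_BijGroup homI)
    fix g h assume "g \<in> carrier G" "h \<in> carrier G"
    then show "(\<lambda>X\<in>rcosets P. X #> inv (g \<otimes> h)) =
        (\<lambda>X\<in>rcosets P. X #> inv g) \<otimes>\<^bsub>BijGroup (rcosets P)\<^esub> (\<lambda>X\<in>rcosets P. X #> inv h)"
      using bij by (auto simp: BijGroup_def compose_def X XX inv_mult_group intro!: restrict_ext)
  qed (use bij in \<open>simp add: BijGroup_def\<close>)
qed

end

section \<open>Fixed points of q-groups, conjugacy and existence of Sylow subgroups\<close>

text \<open>Orbit lengths divide \<open>q ^ k\<close> and add up to \<open>card E\<close>, so some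
  orbit length is prime to \<open>q\<close> and hence equal to 1.\<close>

lemma (in group_action) exists_fixed_point:
  fixes q :: nat
  assumes "prime q" "order G = q ^ k" "finite E" "\<not> q dvd card E"
  shows "\<exists>x\<in>E. \<forall>g\<in>carrier G. (\<phi> g) x = x"
proof -
  have fin: "finite (carrier G)"
    using assms(1,2) prime_gt_0_nat by (metis card.infinite order_def power_not_zero less_numeral_extra(3))
  have "card E = (\<Sum>orb\<in>orbits G E \<phi>. card orb)"
    using disjoint_sum[OF assms(3), of "\<lambda>_. 1::nat"] by simp
  then obtain orb where orb: "orb \<in> orbits G E \<phi>" "\<not> q dvd card orb"
    using assms(4) by (metis dvd_sum)
  then obtain x where x: "x \<in> E" "orb = orbit G \<phi> x" by (auto simp: orbits_def)
  have "card orb dvd q ^ k"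
    using orbit_stabilizer_theorem[OF x(1)] assms(2) x(2) by (metis dvd_triv_left)
  then obtain j where "card orb = q ^ j"
    using assms(1) divides_primepow_nat by blast
  with orb(2) have "card orb = 1" by (cases j) auto
  then obtain y where y: "orb = {y}" by (auto simp: card_1_singleton_iff)
  have "(\<phi> g) x \<in> orb" if "g \<in> carrier G" for g
    using that x(2) by (auto simp: orbit_def)
  moreover have "x \<in> orb" using orbit_refl[OF x(1)] x(2) by simp
  ultimately show ?thesis using x(1) y by blast
qed

text \<open>The index of \<open>P\<close> is prime to \<open>q\<close>, so the action of
  \<open>Q\<close> on the cosets of \<open>P\<close> fixes some \<open>P #> g\<close>. Being fixed
  by \<open>Q\<close> means that \<open>g\<close> conjugates \<open>Q\<close> into
  \<open>P\<close>.\<close>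

lemma (in group) sylow_conjugate:
  assumes fin: "finite (carrier G)" and q: "prime q" and P: "sylow_subgroup q P G"
    and Q: "subgroup Q G" "card Q = q ^ k"
  shows "\<exists>g\<in>carrier G. \<forall>x\<in>Q. g \<otimes> x \<otimes> inv g \<in> P"
proof -
  have P': "subgroup P G" "card P = q ^ multiplicity q (order G)"
    using P by (auto simp: sylow_subgroup_def)
  have o: "order G \<noteq> 0" using order_gt_0_iff_finite fin by simp
  interpret A: group_action "G\<lparr>carrier := Q\<rparr>" "rcosets P" "\<lambda>g. \<lambda>X\<in>rcosets P. X #> inv g"
    using group_action.induced_action[OF rcosets_action[OF P'(1)] Q(1)] .
  have ndvd: "\<not> q dvd card (rcosets P)"
  proof
    assume "q dvd card (rcosets P)"
    then have "q ^ Suc (multiplicity q (order G)) dvd order G"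
      using lagrange[OF P'(1)] P'(2) by (metis mult_dvd_mono dvd_refl power_Suc)
    then show False
      using q o by (subst (asm) power_dvd_iff_le_multiplicity) (auto simp: not_prime_unit)
  qed
  have "finite (rcosets P)"
    using fin rcosets_part_G[OF P'(1)] by (metis finite_UnionD)
  with ndvd obtain X where X: "X \<in> rcosets P" "\<And>g. g \<in> Q \<Longrightarrow> X #> inv g = X"
    using A.exists_fixed_point[OF q, of k] Q(2) by (auto simp: order_def)
  obtain g where g: "g \<in> carrier G" "X = P #> g" using X(1) by (auto simp: RCOSETS_def)
  have sub: "P \<subseteq> carrier G" "Q \<subseteq> carrier G" using P'(1) Q(1) subgroup.subset by blast+
  have "g \<otimes> x \<otimes> inv g \<in> P" if "x \<in> Q" for x
  proof -
    \<comment> \<open>The action multiplies by inverses, so the fixed point property is applied to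
      \<open>inv x\<close>.\<close>
    have "P #> g #> inv (inv x) = P #> g"
      using X(2)[of "inv x"] subgroup.m_inv_closed[OF Q(1) that] g(2) by simp
    then have "P #> (g \<otimes> x) = P #> g"
      using sub g(1) that by (simp add: coset_mult_assoc subset_iff)
    then have "P #> (g \<otimes> x) #> inv g = P"
      using sub g(1) by (simp add: coset_mult_assoc)
    then have "P #> (g \<otimes> x \<otimes> inv g) = P"
      using sub g(1) that by (simp add: coset_mult_assoc subset_iff)
    from coset_join1[OF this _ P'(1)] show ?thesis
      using sub g(1) that by (simp add: subset_iff)
  qed
  with g(1) show ?thesis by blast
qed

context group begin

lemma finite_order_pos: "finite (carrier G) \<Longrightarrow> 0 < order G"
  using order_gt_0_iff_finite by simp

lemma card_subgroup_dvd: "subgroup H G \<Longrightarrow> card H dvd order G"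
  using lagrange by (metis dvd_triv_right)

lemma sylow_exists:
  assumes "finite (carrier G)" "prime q"
  shows "\<exists>P. sylow_subgroup q P G"
proof -
  obtain m where "order G = q ^ multiplicity q (order G) * m"
    using multiplicity_dvd by (metis dvdE)
  then show ?thesis
    using sylow_thm[OF assms(2) is_group _ assms(1)] by (auto simp: sylow_subgroup_def)
qed

text \<open>Lagrange bounds the exponent from above, so a lower bound determines it.\<close>

lemma sylow_subgroupI:
  assumes "finite (carrier G)" "prime q" "subgroup P G" "card P = q ^ k"
    and "multiplicity q (order G) \<le> k"
  shows "sylow_subgroup q P G"
proof -
  have "q ^ k dvd order G" using card_subgroup_dvd assms(3,4) by metis
  then have "k \<le> multiplicity q (order G)"
    using finite_order_pos[OF assms(1)] assms(2)
    by (subst (asm) power_dvd_iff_le_multiplicity) (auto simp: not_prime_unit)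
  then show ?thesis using assms by (simp add: sylow_subgroup_def)
qed

lemma sylow_restrict:
  assumes "finite (carrier G)" "prime q" "sylow_subgroup q Q G" "subgroup H G" "Q \<subseteq> H"
  shows "sylow_subgroup q Q (G\<lparr>carrier := H\<rparr>)"
proof -
  have H: "group (G\<lparr>carrier := H\<rparr>)" "finite (carrier (G\<lparr>carrier := H\<rparr>))"
    using assms(1,4) subgroup_imp_group subgroup.subset finite_subset by fastforce+
  have "card H dvd order G" using card_subgroup_dvd assms(4) by blast
  then have "multiplicity q (card H) \<le> multiplicity q (order G)"
    using finite_order_pos[OF assms(1)] by (intro dvd_imp_multiplicity_le) auto
  then show ?thesis
    using group.sylow_subgroupI[OF H assms(2), of Q "multiplicity q (order G)"] assms subgroup_incl
    by (auto simp: sylow_subgroup_def order_def)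
qed

end

section \<open>Sylow subgroups and their normalizers under surjections\<close>

text \<open>The first isomorphism theorem for \<open>h\<close> restricted to \<open>K\<close>,
  combined with Lagrange.\<close>

lemma (in group_hom) card_image_mult_kernel:
  assumes "subgroup K G"
  shows "card (h ` K) * card {x \<in> K. h x = \<one>\<^bsub>H\<^esub>} = card K"
proof -
  interpret K: group_hom "G\<lparr>carrier := K\<rparr>" "H\<lparr>carrier := h ` K\<rparr>" h
    using induced_group_hom[OF assms] .
  let ?N = "kernel (G\<lparr>carrier := K\<rparr>) (H\<lparr>carrier := h ` K\<rparr>) h"
  have "card (carrier ((G\<lparr>carrier := K\<rparr>) Mod ?N)) = card (h ` K)"
    using K.FactGroup_iso_set by (auto simp: iso_def dest!: bij_betw_same_card)
  moreover have "?N = {x \<in> K. h x = \<one>\<^bsub>H\<^esub>}" by (auto simp: kernel_def)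
  ultimately show ?thesis
    using K.G.lagrange[OF K.subgroup_kernel] by (simp add: FactGroup_def order_def)
qed

text \<open>Quotients are treated through this locale: an epimorphism onto a group over any carrier
  type takes the place of the projection to \<open>G Mod N\<close>.\<close>

locale finite_group_epi = group_hom +
  assumes finite_G: "finite (carrier G)"
    and surj: "h ` carrier G = carrier H"
begin

lemma finite_H: "finite (carrier H)"
  using finite_G surj by (metis finite_imageI)

lemma order_eq: "order H * card (kernel G H h) = order G"
  using card_image_mult_kernel[OF G.subgroup_self] surj by (simp add: order_def kernel_def)

lemma order_dvd: "order H dvd order G"
  using order_eq by (metis dvd_triv_left)

text \<open>Let \<open>q ^ i\<close> and \<open>q ^ j\<close> be the orders of the image of
  \<open>P\<close> and of its intersection with the kernel. Then \<open>i + j\<close> is the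
  exponent of \<open>q\<close> in \<open>order G\<close>, and \<open>j\<close> is at most the
  exponent in the order of the kernel, so \<open>i\<close> is at least the exponent in
  \<open>order H\<close>.\<close>

lemma sylow_image:
  assumes q: "prime q" and P: "sylow_subgroup q P G"
  shows "sylow_subgroup q (h ` P) H"
proof -
  define K where "K = {x \<in> P. h x = \<one>\<^bsub>H\<^esub>}"
  have P': "subgroup P G" "card P = q ^ multiplicity q (order G)"
    using P by (auto simp: sylow_subgroup_def)
  have c: "card (h ` P) * card K = card P"
    using card_image_mult_kernel[OF P'(1)] by (simp add: K_def)
  have K_eq: "K = P \<inter> kernel G H h"
    using subgroup.subset[OF P'(1)] by (auto simp: K_def kernel_def)
  then have "subgroup K G"
    using G.subgroups_Inter_pair P'(1) subgroup_kernel by simp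
  then have "subgroup K (G\<lparr>carrier := kernel G H h\<rparr>)"
    using K_eq G.subgroup_incl subgroup_kernel by simp
  then have Kdvd: "card K dvd card (kernel G H h)"
    using group.card_subgroup_dvd[OF G.subgroup_imp_group[OF subgroup_kernel]]
    by (simp add: order_def)
  obtain j where j: "card K = q ^ j"
    using c P'(2) q divides_primepow_nat by (metis dvd_triv_right)
  obtain i where i: "card (h ` P) = q ^ i"
    using c P'(2) q divides_primepow_nat by (metis dvd_triv_left)
  have "q ^ (i + j) = q ^ multiplicity q (order G)"
    using c i j P'(2) by (simp add: power_add)
  then have ij: "i + j = multiplicity q (order G)"
    using q prime_gt_1_nat power_inject_exp by blast
  have pos: "order H \<noteq> 0" "card (kernel G H h) \<noteq> 0"
    using order_eq G.finite_order_pos[OF finite_G] by (metis mult_0 mult_0_right less_irrefl)+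
  have "multiplicity q (order G) = multiplicity q (order H) + multiplicity q (card (kernel G H h))"
    using order_eq pos q by (metis prime_elem_multiplicity_mult_distrib prime_imp_prime_elem)
  moreover have "j \<le> multiplicity q (card (kernel G H h))"
    using Kdvd j pos(2) q
    by (metis power_dvd_iff_le_multiplicity not_prime_unit)
  ultimately have "multiplicity q (order H) \<le> i" using ij by simp
  then show ?thesis
    using H.sylow_subgroupI[OF finite_H q subgroup_img_is_subgroup[OF P'(1)] i] by simp
qed

text \<open>The image of an arbitrary Sylow subgroup \<open>P0\<close> is Sylow in \<open>H\<close>,
  so some \<open>y\<close> conjugates \<open>Q\<close> into it. A preimage of \<open>y\<close>
  conjugates \<open>P0\<close> back to the required lift; equal orders turn the inclusion into an
  equality.\<close>

lemma sylow_lift: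
  assumes q: "prime q" and Q: "sylow_subgroup q Q H"
  obtains P where "sylow_subgroup q P G" "h ` P = Q"
proof -
  obtain P0 where P0: "sylow_subgroup q P0 G"
    using G.sylow_exists[OF finite_G q] by blast
  have Q': "subgroup Q H" "card Q = q ^ multiplicity q (order H)"
    using Q by (auto simp: sylow_subgroup_def)
  obtain y where y: "y \<in> carrier H" "\<And>x. x \<in> Q \<Longrightarrow> y \<otimes>\<^bsub>H\<^esub> x \<otimes>\<^bsub>H\<^esub> inv\<^bsub>H\<^esub> y \<in> h ` P0"
    using H.sylow_conjugate[OF finite_H q sylow_image[OF q P0] Q'] by blast
  then obtain g where g: "g \<in> carrier G" "y = h g" using surj by blast
  define P where "P = (\<lambda>p. inv g \<otimes> p \<otimes> inv (inv g)) ` P0"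
  have sub: "P0 \<subseteq> carrier G" "Q \<subseteq> carrier H"
    using P0 Q' subgroup.subset by (auto simp: sylow_subgroup_def)
  have P: "sylow_subgroup q P G"
    using P0 G.conjugate_subgroup[of P0 "inv g"] g(1) by (auto simp: sylow_subgroup_def P_def)
  have "Q \<subseteq> h ` P"
  proof
    fix x assume x: "x \<in> Q"
    then obtain p where p: "p \<in> P0" "y \<otimes>\<^bsub>H\<^esub> x \<otimes>\<^bsub>H\<^esub> inv\<^bsub>H\<^esub> y = h p" using y(2) by blast
    have xc: "x \<in> carrier H" using x sub by blast
    have "h (inv g \<otimes> p \<otimes> inv (inv g)) = inv\<^bsub>H\<^esub> y \<otimes>\<^bsub>H\<^esub> (y \<otimes>\<^bsub>H\<^esub> x \<otimes>\<^bsub>H\<^esub> inv\<^bsub>H\<^esub> y) \<otimes>\<^bsub>H\<^esub> y"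
      using p g sub by (simp add: subset_iff)
    also have "\<dots> = x"
      using y(1) xc by (simp add: H.m_assoc) (simp add: H.m_assoc[symmetric])
    finally show "x \<in> h ` P" using p(1) by (force simp: P_def)
  qed
  moreover have "card Q = card (h ` P)"
    using sylow_image[OF q P] Q'(2) by (simp add: sylow_subgroup_def)
  moreover have "finite (h ` P)"
    using finite_subset[OF sub(1) finite_G] by (simp add: P_def)
  ultimately show thesis using that P card_subset_eq by metis
qed

text \<open>The harder inclusion is the Frattini argument in the preimage \<open>K\<close> of the
  image of \<open>P\<close>. A preimage \<open>x\<close> of \<open>y\<close> conjugates
  \<open>P\<close> to another Sylow subgroup of \<open>K\<close>, which some \<open>k\<close> in
  \<open>K\<close> carries back, so \<open>k \<otimes> x\<close> normalizes
  \<open>P\<close>.\<close>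

lemma normalizer_sylow_image:
  assumes q: "prime q" and P: "sylow_subgroup q P G"
  shows "normalizer H (h ` P) = h ` normalizer G P"
proof
  have P': "subgroup P G" "card P = q ^ multiplicity q (order G)"
    using P by (auto simp: sylow_subgroup_def)
  have hP: "subgroup (h ` P) H" using subgroup_img_is_subgroup P'(1) by blast
  have sub: "P \<subseteq> carrier G" using P' subgroup.subset by blast
  show "h ` normalizer G P \<subseteq> normalizer H (h ` P)"
  proof
    fix y assume "y \<in> h ` normalizer G P"
    then obtain x where x: "x \<in> carrier G" "\<forall>p\<in>P. x \<otimes> p \<otimes> inv x \<in> P" "y = h x"
      by (auto simp: G.mem_normalizer_iff[OF finite_G P'(1)])
    have "y \<otimes>\<^bsub>H\<^esub> h p \<otimes>\<^bsub>H\<^esub> inv\<^bsub>H\<^esub> y = h (x \<otimes> p \<otimes> inv x)" if "p \<in> P" for p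
      using that x sub by (simp add: subset_iff)
    then show "y \<in> normalizer H (h ` P)"
      using x by (auto simp: H.mem_normalizer_iff[OF finite_H hP])
  qed
  show "normalizer H (h ` P) \<subseteq> h ` normalizer G P"
  proof
    fix y assume "y \<in> normalizer H (h ` P)"
    then have y: "y \<in> carrier H" "\<And>p. p \<in> P \<Longrightarrow> y \<otimes>\<^bsub>H\<^esub> h p \<otimes>\<^bsub>H\<^esub> inv\<^bsub>H\<^esub> y \<in> h ` P"
      by (auto simp: H.mem_normalizer_iff[OF finite_H hP])
    then obtain x where x: "x \<in> carrier G" "y = h x" using surj by blast
    define K where "K = {k \<in> carrier G. h k \<in> h ` P}"
    have K: "subgroup K G"
      unfolding K_def using subgroup.one_closed[OF hP]
      by (intro G.subgroupI)
        (auto simp: subgroup.m_inv_closed[OF hP] subgroup.m_closed[OF hP] intro!: exI[of _ \<one>])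
    define R where "R = (\<lambda>p. x \<otimes> p \<otimes> inv x) ` P"
    have "R \<subseteq> K"
      using y x sub by (auto simp: R_def K_def subset_iff)
    have "subgroup R (G\<lparr>carrier := K\<rparr>)"
      using G.subgroup_incl[OF _ K \<open>R \<subseteq> K\<close>] G.conjugate_subgroup(1)[OF P'(1) x(1)]
      by (simp add: R_def)
    moreover have "card R = q ^ multiplicity q (order G)"
      using G.conjugate_subgroup(2)[OF P'(1) x(1)] P'(2) by (simp add: R_def)
    moreover have "P \<subseteq> K" using sub by (auto simp: K_def)
    moreover have "finite K" using finite_G by (simp add: K_def)
    ultimately obtain k where k: "k \<in> K" "\<forall>r\<in>R. k \<otimes> r \<otimes> inv k \<in> P"
      using group.sylow_conjugate[OF G.subgroup_imp_group[OF K] _ q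
          G.sylow_restrict[OF finite_G q P K], of R] G.m_inv_consistent[OF K]
      by force
    have kc: "k \<in> carrier G" using k by (simp add: K_def)
    have "k \<otimes> x \<otimes> p \<otimes> inv (k \<otimes> x) \<in> P" if "p \<in> P" for p
    proof -
      have "k \<otimes> x \<otimes> p \<otimes> inv (k \<otimes> x) = k \<otimes> (x \<otimes> p \<otimes> inv x) \<otimes> inv k"
        using that sub kc x(1) by (simp add: G.m_assoc G.inv_mult_group subset_iff)
      then show ?thesis using k(2) that by (simp add: R_def)
    qed
    then have kx: "k \<otimes> x \<in> normalizer G P"
      using kc x(1) by (simp add: G.mem_normalizer_iff[OF finite_G P'(1)])
    \<comment> \<open>The factor \<open>k\<close> spoils the image \<open>y\<close>. It has the same
      image as some \<open>p\<close> in \<open>P\<close>, and dividing by \<open>p\<close>, which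
      normalizes \<open>P\<close>, restores \<open>y\<close>.\<close>
    obtain p where p: "p \<in> P" "h k = h p" using k(1) by (auto simp: K_def)
    have "inv p \<otimes> (k \<otimes> x) \<in> normalizer G P"
      using kx p(1) G.subset_normalizer[OF finite_G P'(1)] G.subgroup_normalizer[OF P'(1)]
      by (meson subgroup.m_closed subgroup.m_inv_closed subsetD)
    moreover have "h (inv p \<otimes> (k \<otimes> x)) = y"
      using p sub kc x by (simp add: subset_iff H.m_assoc[symmetric])
    ultimately show "y \<in> h ` normalizer G P" by blast
  qed
qed

end

lemma finite_group_epiI:
  assumes "group_hom G H h" "finite (carrier G)" "h ` carrier G = carrier H"
  shows "finite_group_epi G H h"
  using assms by (simp add: finite_group_epi_def finite_group_epi_axioms_def)

section \<open>Factoring homomorphisms, and quotients as epimorphic images\<close>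

text \<open>Universal property of the quotient map: elements with the same image under
  \<open>h\<close> differ by an element of its kernel, so \<open>g\<close> is constant on the fibres
  of \<open>h\<close>.\<close>

lemma (in finite_group_epi) factor_hom:
  assumes g: "group_hom G K g" and "\<And>x. x \<in> carrier G \<Longrightarrow> h x = \<one>\<^bsub>H\<^esub> \<Longrightarrow> g x = \<one>\<^bsub>K\<^esub>"
  obtains f where "group_hom H K f" "\<And>x. x \<in> carrier G \<Longrightarrow> f (h x) = g x"
proof -
  interpret g: group_hom G K g by fact
  \<comment> \<open>An arbitrary section of \<open>h\<close>. It need not be multiplicative;
    composing with \<open>g\<close> removes the dependence on the choice.\<close>
  define s where "s = inv_into (carrier G) h"
  have s: "s y \<in> carrier G" "h (s y) = y" if "y \<in> carrier H" for y
    using that surj by (auto simp: s_def inv_into_into f_inv_into_f)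
  have eq: "g x = g y" if "x \<in> carrier G" "y \<in> carrier G" "h x = h y" for x y
  proof -
    have "g (x \<otimes> inv y) = \<one>\<^bsub>K\<^esub>" using that by (intro assms(2)) auto
    then have "g x \<otimes>\<^bsub>K\<^esub> inv\<^bsub>K\<^esub> g y = \<one>\<^bsub>K\<^esub>" using that by simp
    then show ?thesis
      using that g.hom_closed g.H.inv_equality g.H.inv_inv g.H.inv_closed by metis
  qed
  have fh: "g (s (h x)) = g x" if "x \<in> carrier G" for x
    using that by (intro eq) (auto simp: s)
  have "(\<lambda>y. g (s y)) \<in> hom H K"
  proof (rule homI)
    fix x y assume xy: "x \<in> carrier H" "y \<in> carrier H"
    then have "g (s (x \<otimes>\<^bsub>H\<^esub> y)) = g (s x \<otimes> s y)"
      by (intro eq) (auto simp: s)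
    then show "g (s (x \<otimes>\<^bsub>H\<^esub> y)) = g (s x) \<otimes>\<^bsub>K\<^esub> g (s y)"
      using xy by (simp add: s)
  qed (simp add: s)
  then have "group_hom H K (\<lambda>y. g (s y))"
    by (simp add: group_hom_def group_hom_axioms_def g.H.is_group)
  from that[OF this fh] show thesis .
qed

lemma (in group_hom) finite_group_epi_restrict:
  assumes "finite (carrier G)" "subgroup K G"
  shows "finite_group_epi (G\<lparr>carrier := K\<rparr>) (H\<lparr>carrier := h ` K\<rparr>) h"
  using induced_group_hom[OF assms(2)] finite_subset[OF subgroup.subset[OF assms(2)] assms(1)]
  by (simp add: finite_group_epi_def finite_group_epi_axioms_def)

text \<open>From here on, arguments about \<open>G Mod N\<close> can use maps onto members of
  \<open>F\<close> and their kernels in place of cosets.\<close>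

lemma in_class_FactGroup_iff:
  assumes "group G" "finite (carrier G)" "group_class F" "N \<lhd> G"
  shows "in_class (G Mod N) F \<longleftrightarrow>
    (\<exists>X\<in>F. \<exists>f. finite_group_epi G X f \<and> kernel G X f = N)"
proof
  interpret N: normal N G by fact
  assume "in_class (G Mod N) F"
  then obtain X f where X: "X \<in> F" "f \<in> iso (G Mod N) X"
    by (auto simp: in_class_def is_iso_def)
  have gX: "group X" using X(1) assms(3) by (auto simp: group_class_def)
  interpret f: group_hom "G Mod N" X f
    using X(2) gX N.factorgroup_is_group by (auto simp: group_hom_def group_hom_axioms_def iso_def)
  let ?f = "\<lambda>x. f (N #>\<^bsub>G\<^esub> x)"
  have hom: "?f \<in> hom G X"
    using hom_compose[OF N.r_coset_hom_Mod f.homh] by (simp add: o_def)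
  have surj: "?f ` carrier G = carrier X"
    using X(2) by (simp add: iso_def bij_betw_def carrier_FactGroup image_image)
  have "f (N #>\<^bsub>G\<^esub> x) = \<one>\<^bsub>X\<^esub> \<longleftrightarrow> x \<in> N" if "x \<in> carrier G" for x
  proof -
    have "N \<in> carrier (G Mod N)" "f N = \<one>\<^bsub>X\<^esub>"
      using f.G.one_closed f.hom_one by simp_all
    then have "f (N #>\<^bsub>G\<^esub> x) = \<one>\<^bsub>X\<^esub> \<longleftrightarrow> N #>\<^bsub>G\<^esub> x = N"
      using X(2) that inj_on_eq_iff[of f "carrier (G Mod N)" "N #>\<^bsub>G\<^esub> x" N]
      by (auto simp: iso_def bij_betw_def carrier_FactGroup)
    also have "\<dots> \<longleftrightarrow> x \<in> N"
      using that N.coset_join1[OF _ _ N.subgroup_axioms] N.coset_join2[OF _ N.subgroup_axioms] by blast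
    finally show ?thesis .
  qed
  then have "kernel G X ?f = N"
    using N.subset by (auto simp: kernel_def)
  then show "\<exists>X\<in>F. \<exists>f. finite_group_epi G X f \<and> kernel G X f = N"
    using hom surj X(1) gX assms(1,2)
    by (intro bexI[of _ X] exI[of _ ?f])
      (auto simp: finite_group_epi_def finite_group_epi_axioms_def group_hom_def group_hom_axioms_def)
next
  assume "\<exists>X\<in>F. \<exists>f. finite_group_epi G X f \<and> kernel G X f = N"
  then obtain X f where X: "X \<in> F" "finite_group_epi G X f" "kernel G X f = N" by blast
  interpret f: finite_group_epi G X f by fact
  show "in_class (G Mod N) F"
    using f.FactGroup_iso[OF f.surj] X normal.factorgroup_is_group[OF assms(4)]
    by (auto simp: in_class_def)
qed

section \<open>Chains of residual steps and their transfer between groups\<close>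

text \<open>
  Maximality of \<open>A\<close> in \<open>B\<close> is not required: chains can be refined, so the reflexive
  transitive closure is the same.
\<close>

definition residual_step :: "group_class \<Rightarrow> ('a, 'b) monoid_scheme \<Rightarrow> ('a set \<times> 'a set) set" where
  "residual_step F G = {(A, B). subgroup A G \<and> subgroup B G \<and> A \<subseteq> B \<and>
     (\<exists>X\<in>F. \<exists>f. group_hom (G\<lparr>carrier := B\<rparr>) X f \<and> {x \<in> B. f x = \<one>\<^bsub>X\<^esub>} \<subseteq> A)}"

lemma residual_stepI:
  assumes "subgroup A G" "subgroup B G" "A \<subseteq> B" "X \<in> F" "group_hom (G\<lparr>carrier := B\<rparr>) X f"
    and "\<And>x. x \<in> B \<Longrightarrow> f x = \<one>\<^bsub>X\<^esub> \<Longrightarrow> x \<in> A"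
  shows "(A, B) \<in> residual_step F G"
  using assms by (auto simp: residual_step_def)

lemma residual_stepE:
  assumes "(A, B) \<in> residual_step F G"
  obtains X f where "subgroup A G" "subgroup B G" "A \<subseteq> B" "X \<in> F" "group_hom (G\<lparr>carrier := B\<rparr>) X f"
    and "\<And>x. x \<in> B \<Longrightarrow> f x = \<one>\<^bsub>X\<^esub> \<Longrightarrow> x \<in> A"
  using assms by (auto simp: residual_step_def)

lemma residual_steps_subset:
  assumes "(A, B) \<in> (residual_step F G)\<^sup>*"
  shows "A \<subseteq> B"
  using assms by induction (auto simp: residual_step_def)

text \<open>Carries a whole chain through an intersection, image or preimage, once this is known for
  a single step.\<close>

lemma rtrancl_image:
  assumes "(a, b) \<in> R\<^sup>*" and "\<And>x y. (x, y) \<in> R \<Longrightarrow> (f x, f y) \<in> S"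
  shows "(f a, f b) \<in> S\<^sup>*"
  using assms(1) by induction (auto dest: assms(2) intro: rtrancl_into_rtrancl)

context group begin

text \<open>The homomorphism is restricted to \<open>B \<inter> K\<close>. Its image may shrink,
  which is allowed because a step only asks for a map into \<open>X\<close>.\<close>

lemma residual_step_restrict:
  assumes "subgroup K G" "(A, B) \<in> residual_step F G"
  shows "(A \<inter> K, B \<inter> K) \<in> residual_step F G"
  using assms(2)
proof (rule residual_stepE)
  fix X f assume *: "subgroup A G" "subgroup B G" "A \<subseteq> B" "X \<in> F" "group_hom (G\<lparr>carrier := B\<rparr>) X f"
    "\<And>x. x \<in> B \<Longrightarrow> f x = \<one>\<^bsub>X\<^esub> \<Longrightarrow> x \<in> A"
  have "subgroup (B \<inter> K) (G\<lparr>carrier := B\<rparr>)"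
    using * assms(1) subgroups_Inter_pair subgroup_incl by simp
  from group_hom.induced_group_hom'[OF *(5) this] show ?thesis
    using * assms(1) subgroups_Inter_pair by (intro residual_stepI[of _ _ _ X]) auto
qed

lemma residual_steps_restrict:
  assumes "subgroup K G" "(A, B) \<in> (residual_step F G)\<^sup>*"
  shows "(A \<inter> K, B \<inter> K) \<in> (residual_step F G)\<^sup>*"
  by (rule rtrancl_image[OF assms(2) residual_step_restrict[OF assms(1)]])

text \<open>Intersecting the chain of \<open>A\<close> with \<open>K\<close> leads from
  \<open>A \<inter> K\<close> up to \<open>K\<close>, where the chain of \<open>K\<close> takes
  over.\<close>

lemma residual_step_Int:
  assumes "subgroup A G" "subgroup K G" "(A, carrier G) \<in> (residual_step F G)\<^sup>*"
    "(K, carrier G) \<in> (residual_step F G)\<^sup>*"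
  shows "(A \<inter> K, carrier G) \<in> (residual_step F G)\<^sup>*"
  using residual_steps_restrict[OF assms(2,3)] assms(4) subgroup.subset[OF assms(2)]
  by (simp add: Int_absorb1)

lemma residual_step_subgroup_iff:
  assumes "subgroup K G" "B \<subseteq> K"
  shows "(A, B) \<in> residual_step F (G\<lparr>carrier := K\<rparr>) \<longleftrightarrow> (A, B) \<in> residual_step F G"
  using assms incl_subgroup[OF assms(1)] subgroup_incl[OF _ assms(1)]
  by (fastforce simp: residual_step_def)

lemma residual_steps_subgroup_iff:
  assumes "subgroup K G" "B \<subseteq> K"
  shows "(A, B) \<in> (residual_step F (G\<lparr>carrier := K\<rparr>))\<^sup>* \<longleftrightarrow> (A, B) \<in> (residual_step F G)\<^sup>*"
proof
  assume "(A, B) \<in> (residual_step F (G\<lparr>carrier := K\<rparr>))\<^sup>*"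
  then show "(A, B) \<in> (residual_step F G)\<^sup>*"
    by (rule rtrancl_mono[THEN subsetD, rotated])
      (auto simp: residual_step_def dest: incl_subgroup[OF assms(1)])
next
  assume "(A, B) \<in> (residual_step F G)\<^sup>*"
  then show "(A, B) \<in> (residual_step F (G\<lparr>carrier := K\<rparr>))\<^sup>*"
    using assms(2)
  proof (induction rule: converse_rtrancl_induct)
    case (step A C)
    then have "C \<subseteq> K" using residual_steps_subset by blast
    then show ?case
      using step residual_step_subgroup_iff[OF assms(1)] converse_rtrancl_into_rtrancl by metis
  qed auto
qed

end

lemma (in group_hom) subgroup_vimage:
  assumes "subgroup S H"
  shows "subgroup {x \<in> carrier G. h x \<in> S} G"
  using subgroup.one_closed[OF assms]
  by (intro G.subgroupI)
    (auto simp: subgroup.m_inv_closed[OF assms] subgroup.m_closed[OF assms] intro!: exI[of _ \<one>])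

lemma (in group_hom) vimage_carrier: "{x \<in> carrier G. h x \<in> carrier H} = carrier G"
  by auto

lemma (in group_hom) residual_step_vimage:
  assumes "(A, B) \<in> residual_step F H"
  shows "({x \<in> carrier G. h x \<in> A}, {x \<in> carrier G. h x \<in> B}) \<in> residual_step F G"
  using assms
proof (rule residual_stepE)
  fix X f assume *: "subgroup A H" "subgroup B H" "A \<subseteq> B" "X \<in> F" "group_hom (H\<lparr>carrier := B\<rparr>) X f"
    "\<And>x. x \<in> B \<Longrightarrow> f x = \<one>\<^bsub>X\<^esub> \<Longrightarrow> x \<in> A"
  interpret f: group_hom "H\<lparr>carrier := B\<rparr>" X f by fact
  have "(\<lambda>x. f (h x)) \<in> hom (G\<lparr>carrier := {x \<in> carrier G. h x \<in> B}\<rparr>) X"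
    using f.homh by (auto simp: hom_def Pi_iff)
  then have "group_hom (G\<lparr>carrier := {x \<in> carrier G. h x \<in> B}\<rparr>) X (\<lambda>x. f (h x))"
    using G.subgroup_imp_group[OF subgroup_vimage[OF *(2)]] by (simp add: group_hom_def group_hom_axioms_def f.H.is_group)
  then show ?thesis
    using *(3,4,6) subgroup_vimage[OF *(1)] subgroup_vimage[OF *(2)]
    by (intro residual_stepI[of _ _ _ X]) auto
qed


text \<open>Heredity puts the image \<open>Y\<close> of \<open>f\<close> into \<open>F\<close>, and
  dividing by the image \<open>L\<close> of the kernel of \<open>h\<close> stays in
  \<open>F\<close>. The composite map to this quotient kills the kernel of \<open>h\<close>, so it
  factors through \<open>h\<close>; the factor \<open>k\<close> serves the image step.\<close>

lemma (in group_hom) residual_step_image: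
  assumes F: "formation F" "hereditary F" and fin: "finite (carrier G)"
    and "(A, B) \<in> residual_step F G"
  shows "(h ` A, h ` B) \<in> residual_step F H"
  using assms(4)
proof (rule residual_stepE)
  fix X f assume *: "subgroup A G" "subgroup B G" "A \<subseteq> B" "X \<in> F" "group_hom (G\<lparr>carrier := B\<rparr>) X f"
    "\<And>x. x \<in> B \<Longrightarrow> f x = \<one>\<^bsub>X\<^esub> \<Longrightarrow> x \<in> A"
  interpret f: group_hom "G\<lparr>carrier := B\<rparr>" X f by fact
  interpret h: finite_group_epi "G\<lparr>carrier := B\<rparr>" "H\<lparr>carrier := h ` B\<rparr>" h
    using finite_group_epi_restrict[OF fin *(2)] .
  define Y where "Y = X\<lparr>carrier := f ` B\<rparr>"
  have Y: "Y \<in> F" using f.img_is_subgroup *(4) F(2) by (auto simp: hereditary_def Y_def)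
  have fY: "group_hom (G\<lparr>carrier := B\<rparr>) Y f" "f ` B = carrier Y"
    using f.induced_group_hom[OF f.G.subgroup_self] by (simp_all add: Y_def)
  interpret f': group_hom "G\<lparr>carrier := B\<rparr>" Y f by fact
  define L where "L = f ` kernel (G\<lparr>carrier := B\<rparr>) (H\<lparr>carrier := h ` B\<rparr>) h"
  have L: "L \<lhd> Y"
    using normal.surj_hom_normal_subgroup[OF h.normal_kernel fY(1)] fY(2) by (simp add: L_def)
  have "finite (carrier Y)" using h.finite_G by (simp add: Y_def)
  moreover have "in_class (Y Mod L) F" using F(1) Y L by (auto simp: formation_def)
  ultimately obtain Z g where Z: "Z \<in> F" "finite_group_epi Y Z g" "kernel Y Z g = L"
    using in_class_FactGroup_iff[OF f'.H.is_group _ _ L] F(1) by (auto simp: formation_def)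
  interpret g: finite_group_epi Y Z g by fact
  have "group_hom (G\<lparr>carrier := B\<rparr>) Z (\<lambda>x. g (f x))"
    using Group.hom_compose[OF f'.homh g.homh] f.G.is_group g.H.is_group
    by (simp add: group_hom_def group_hom_axioms_def o_def)
  moreover have "g (f x) = \<one>\<^bsub>Z\<^esub>" if "x \<in> B" "h x = \<one>\<^bsub>H\<^esub>" for x
  proof -
    have "f x \<in> kernel Y Z g" using that Z(3) by (auto simp: L_def kernel_def)
    then show ?thesis by (simp add: kernel_def)
  qed
  ultimately obtain k where k: "group_hom (H\<lparr>carrier := h ` B\<rparr>) Z k" "\<And>x. x \<in> B \<Longrightarrow> k (h x) = g (f x)"
    by (rule h.factor_hom[of Z "\<lambda>x. g (f x)"]) simp_all
  \<comment> \<open>If \<open>k\<close> kills \<open>h b\<close>, then \<open>f b = f c\<close> for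
    some \<open>c\<close> in the kernel of \<open>h\<close>. So \<open>b \<otimes> inv c\<close> is
    in the kernel of \<open>f\<close>, hence in \<open>A\<close>, and its image under
    \<open>h\<close> is still \<open>h b\<close>.\<close>
  have "h b \<in> h ` A" if b: "b \<in> B" "k (h b) = \<one>\<^bsub>Z\<^esub>" for b
  proof -
    have "f b \<in> carrier Y" using b(1) fY(2) by blast
    moreover have "g (f b) = \<one>\<^bsub>Z\<^esub>" by (rule trans[OF k(2)[OF b(1), symmetric] b(2)])
    ultimately have "f b \<in> L" unfolding Z(3)[symmetric] kernel_def by blast
    then obtain c where "c \<in> kernel (G\<lparr>carrier := B\<rparr>) (H\<lparr>carrier := h ` B\<rparr>) h" "f b = f c"
      unfolding L_def by (rule imageE)
    then have c: "c \<in> B" "h c = \<one>\<^bsub>H\<^esub>" "f b = f c" by (simp_all add: kernel_def)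
    have Bc: "B \<subseteq> carrier G" by (rule subgroup.subset[OF *(2)])
    have ic: "inv c \<in> B" by (rule subgroup.m_inv_closed[OF *(2) c(1)])
    have bc: "b \<otimes> inv c \<in> B" by (rule subgroup.m_closed[OF *(2) b(1) ic])
    have "f (b \<otimes> inv c) = f b \<otimes>\<^bsub>X\<^esub> f (inv c)"
      using f.hom_mult b(1) ic by simp
    also have "f (inv c) = inv\<^bsub>X\<^esub> f c"
      using f.hom_inv[of c] c(1) G.m_inv_consistent[OF *(2) c(1)] by simp
    finally have "f (b \<otimes> inv c) = \<one>\<^bsub>X\<^esub>" using c f.hom_closed[of c] by simp
    then have "b \<otimes> inv c \<in> A" by (rule *(6)[OF bc])
    moreover have "h (b \<otimes> inv c) = h b"
      using b(1) c(1,2) Bc by (simp add: subset_iff)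
    ultimately show ?thesis using imageI[of "b \<otimes> inv c" A h] by simp
  qed
  then have "y \<in> h ` A" if "y \<in> h ` B" "k y = \<one>\<^bsub>Z\<^esub>" for y
    using that by blast
  from residual_stepI[OF _ _ _ Z(1) k(1) this] show ?thesis
    using *(1-3) subgroup_img_is_subgroup image_mono by blast
qed

section \<open>Residuals, and the comparison of maximal chains with residual steps\<close>

lemma (in group) normal_carrier: "carrier G \<lhd> G"
  by (rule normal_invI[OF subgroup_self]) simp

lemma group_classD:
  assumes "group_class F" "X \<in> F"
  shows "group X" "finite (carrier X)"
  using assms by (simp_all add: group_class_def)

lemma formation_group_class: "formation F \<Longrightarrow> group_class F"
  by (simp add: formation_def)

lemma formation_quotient: "formation F \<Longrightarrow> G \<in> F \<Longrightarrow> N \<lhd> G \<Longrightarrow> in_class (G Mod N) F"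
  by (simp add: formation_def)

lemma trivial_member:
  assumes "formation F" "F \<noteq> {}"
  obtains Z where "Z \<in> F" "carrier Z = {\<one>\<^bsub>Z\<^esub>}"
proof -
  obtain X where X: "X \<in> F" using assms(2) by blast
  note F = formation_group_class[OF assms(1)]
  note gX = group_classD[OF F X]
  have n: "carrier X \<lhd> X"
    by (rule group.normal_carrier[OF gX(1)])
  then have "in_class (X Mod carrier X) F"
    by (rule formation_quotient[OF assms(1) X])
  then obtain Z f where Z: "Z \<in> F" "finite_group_epi X Z f" "kernel X Z f = carrier X"
    using in_class_FactGroup_iff[OF gX F n] by blast
  interpret finite_group_epi X Z f by fact
  have "carrier Z = {\<one>\<^bsub>Z\<^esub>}"
    using trivial_hom_iff Z(3) surj by simp
  with that Z(1) show thesis .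
qed

text \<open>Finiteness gives a candidate of minimal order, and closure of formations under
  intersections makes it smallest for inclusion. This justifies the \<open>LEAST\<close> in
  \<open>residual\<close>.\<close>

lemma residual_least:
  fixes G :: "nat monoid"
  assumes F: "formation F" "F \<noteq> {}" and G: "group G" "finite (carrier G)"
  shows "residual G F \<lhd> G" "in_class (G Mod residual G F) F"
    and "\<And>R. R \<lhd> G \<Longrightarrow> in_class (G Mod R) F \<Longrightarrow> residual G F \<subseteq> R"
proof -
  note cF = formation_group_class[OF F(1)]
  obtain Z where Z: "Z \<in> F" "carrier Z = {\<one>\<^bsub>Z\<^esub>}" using trivial_member[OF F] .
  note gZ = group_classD(1)[OF cF Z(1)]
  \<comment> \<open>The constant map onto the trivial member shows that \<open>carrier G\<close> is
    a candidate, so the minimum is taken over a non-empty family.\<close>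
  have "finite_group_epi G Z (\<lambda>x. \<one>\<^bsub>Z\<^esub>)"
    using G gZ Z(2) group.is_monoid[OF gZ] monoid.l_one[OF group.is_monoid[OF gZ]]
      monoid.one_closed[OF group.is_monoid[OF G(1)]]
    by (auto simp: finite_group_epi_def finite_group_epi_axioms_def group_hom_def
        group_hom_axioms_def hom_def)
  moreover have "kernel G Z (\<lambda>x. \<one>\<^bsub>Z\<^esub>) = carrier G" by (auto simp: kernel_def)
  moreover have "carrier G \<lhd> G"
    by (rule group.normal_carrier[OF G(1)])
  ultimately have ex: "carrier G \<lhd> G \<and> in_class (G Mod carrier G) F"
    using in_class_FactGroup_iff[OF G cF] Z(1) by blast
  define R where "R = (ARG_MIN card R. R \<lhd> G \<and> in_class (G Mod R) F)"
  have R: "R \<lhd> G" "in_class (G Mod R) F"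
    using arg_min_natI[of "\<lambda>R. R \<lhd> G \<and> in_class (G Mod R) F", OF ex] by (auto simp: R_def)
  have min: "R \<subseteq> S" if S: "S \<lhd> G" "in_class (G Mod S) F" for S
  proof -
    have "R \<inter> S \<lhd> G \<and> in_class (G Mod (R \<inter> S)) F"
      using R S F(1) G group.normal_subgroup_intersect[OF G(1)] by (simp add: formation_def)
    then have "card R \<le> card (R \<inter> S)"
      unfolding R_def by (rule arg_min_nat_le)
    moreover have "finite R"
      using R(1) G(2) normal_imp_subgroup subgroup.subset finite_subset by metis
    ultimately have "R \<inter> S = R" by (intro card_seteq) auto
    then show ?thesis by blast
  qed
  have "residual G F = R"
    unfolding residual_def by (rule Least_equality) (use R min in auto)
  then show "residual G F \<lhd> G" "in_class (G Mod residual G F) F"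
    "\<And>R. R \<lhd> G \<Longrightarrow> in_class (G Mod R) F \<Longrightarrow> residual G F \<subseteq> R"
    using R min by auto
qed

text \<open>Turning the links of the chain in \<open>subnormal_wrt\<close> into a relation allows
  induction along its reflexive transitive closure in place of indices.\<close>

definition maximal_step :: "group_class \<Rightarrow> ('a, 'b) monoid_scheme \<Rightarrow> ('a set \<times> 'a set) set" where
  "maximal_step F G = {(A, B). maximal_subgroup A (G\<lparr>carrier := B\<rparr>) \<and>
     residual (G\<lparr>carrier := B\<rparr>) F \<subseteq> A}"

lemma subnormal_wrt_iff_maximal_steps:
  "subnormal_wrt F H G \<longleftrightarrow> subgroup H G \<and> (H, carrier G) \<in> (maximal_step F G)\<^sup>*"
  by (simp add: subnormal_wrt_def maximal_step_def rtrancl_power relpow_fun_conv)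

lemma maximal_step_epi:
  fixes G :: "nat monoid"
  assumes F: "formation F" "F \<noteq> {}" and G: "group G" "finite (carrier G)"
    and B: "subgroup B G" and AB: "(A, B) \<in> maximal_step F G"
  obtains X f where "subgroup A G" "A \<subseteq> B" "X \<in> F" "finite_group_epi (G\<lparr>carrier := B\<rparr>) X f"
    "\<And>x. x \<in> B \<Longrightarrow> f x = \<one>\<^bsub>X\<^esub> \<Longrightarrow> x \<in> A"
proof -
  interpret group G by fact
  let ?B = "G\<lparr>carrier := B\<rparr>"
  have gB: "group ?B" "finite (carrier ?B)"
    using subgroup_imp_group B finite_subset[OF subgroup.subset[OF B] G(2)] by simp_all
  obtain X f where X: "X \<in> F" "finite_group_epi ?B X f" "kernel ?B X f = residual ?B F"
    using in_class_FactGroup_iff[OF gB formation_group_class[OF F(1)] residual_least(1)[OF F gB]]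
      residual_least(2)[OF F gB] by blast
  have A: "subgroup A ?B" "residual ?B F \<subseteq> A"
    using AB by (auto simp: maximal_step_def maximal_subgroup_def)
  show thesis
    using that[of X f] X A incl_subgroup[OF B A(1)] subgroup.subset[OF A(1)]
    by (auto simp: kernel_def)
qed

text \<open>Induction on the order of \<open>B\<close>: a maximal subgroup \<open>M\<close> of
  \<open>B\<close> above \<open>A\<close> is inserted, and the step from \<open>A\<close> to
  \<open>B\<close> restricts to one from \<open>A\<close> to \<open>M\<close>.\<close>

lemma residual_step_refine:
  fixes G :: "nat monoid"
  assumes F: "formation F" "hereditary F" "F \<noteq> {}" and G: "group G" "finite (carrier G)"
    and "(A, B) \<in> residual_step F G"
  shows "(A, B) \<in> (maximal_step F G)\<^sup>*"
  using assms(6)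
proof (induction "card B" arbitrary: B rule: less_induct)
  case (less B)
  interpret group G by fact
  from less.prems show ?case
  proof (rule residual_stepE)
    fix X f assume *: "subgroup A G" "subgroup B G" "A \<subseteq> B" "X \<in> F" "group_hom (G\<lparr>carrier := B\<rparr>) X f"
      "\<And>x. x \<in> B \<Longrightarrow> f x = \<one>\<^bsub>X\<^esub> \<Longrightarrow> x \<in> A"
    let ?B = "G\<lparr>carrier := B\<rparr>"
    have gB: "group ?B" "finite (carrier ?B)" "finite B"
      using subgroup_imp_group *(2) finite_subset[OF subgroup.subset[OF *(2)] G(2)] by simp_all
    show ?case
    proof (cases "A = B")
      case False
      let ?S = "{K. subgroup K G \<and> K \<subset> B}"
      have "finite ?S"
        by (rule finite_subset[of _ "Pow B"]) (use gB(3) in auto)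
      then obtain M where M: "subgroup M G" "M \<subset> B" "A \<subseteq> M"
        and max: "\<And>K. subgroup K G \<Longrightarrow> K \<subset> B \<Longrightarrow> M \<subseteq> K \<Longrightarrow> M = K"
        using finite_has_maximal2[of ?S A] *(1,3) False
        by (simp add: psubset_eq) (metis psubset_eq)
      have "maximal_subgroup M ?B"
        unfolding maximal_subgroup_def
      proof (intro conjI allI impI)
        show "subgroup M ?B" using subgroup_incl[OF M(1) *(2)] M(2) by blast
        show "M \<noteq> carrier ?B" using M(2) by auto
        fix K assume K: "subgroup K ?B" "M \<subseteq> K"
        then show "K = M \<or> K = carrier ?B"
          using max[of K] incl_subgroup[OF *(2) K(1)] subgroup.subset[OF K(1)] by auto
      qed
      \<comment> \<open>By heredity the image of \<open>f\<close> is in \<open>F\<close>, so the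
        residual lies in the kernel of \<open>f\<close>, which is contained in \<open>A\<close> and
        hence in \<open>M\<close>.\<close>
      moreover have "residual ?B F \<subseteq> M"
      proof -
        interpret f: group_hom ?B X f by fact
        let ?Y = "X\<lparr>carrier := f ` B\<rparr>"
        have Y: "?Y \<in> F" using f.img_is_subgroup *(4) F(2) by (simp add: hereditary_def)
        have "finite_group_epi ?B ?Y f"
          using f.finite_group_epi_restrict[OF gB(2) f.G.subgroup_self] by simp
        moreover have k: "kernel ?B ?Y f = kernel ?B X f" by (simp add: kernel_def)
        ultimately have "in_class (?B Mod kernel ?B X f) F"
          using in_class_FactGroup_iff[OF gB(1,2) formation_group_class[OF F(1)] f.normal_kernel] Y
          by blast
        then have "residual ?B F \<subseteq> kernel ?B X f"
          using residual_least(3)[OF F(1,3) gB(1,2) f.normal_kernel] by blast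
        then show ?thesis using *(6) M(3) by (auto simp: kernel_def)
      qed
      ultimately have MB: "(M, B) \<in> maximal_step F G" by (simp add: maximal_step_def)
      have "A \<inter> M = A" "B \<inter> M = M" using M by auto
      then have "(A, M) \<in> residual_step F G"
        using residual_step_restrict[OF M(1) less.prems] by simp
      then have "(A, M) \<in> (maximal_step F G)\<^sup>*"
        using less.hyps psubset_card_mono[OF gB(3) M(2)] by blast
      then show ?thesis using MB by (rule rtrancl_into_rtrancl)
    qed simp
  qed
qed

text \<open>One direction reads each maximal link as a residual step through the quotient by the
  residual; the other refines each residual step into maximal links.\<close>

lemma subnormal_wrt_iff:
  fixes G :: "nat monoid"
  assumes F: "formation F" "hereditary F" "F \<noteq> {}" and G: "group G" "finite (carrier G)"
  shows "subnormal_wrt F H G \<longleftrightarrow> subgroup H G \<and> (H, carrier G) \<in> (residual_step F G)\<^sup>*"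
proof -
  interpret group G by fact
  \<comment> \<open>A maximal link from \<open>A\<close> to \<open>C\<close> only makes
    \<open>A\<close> a subgroup of \<open>C\<close>, so being a subgroup of \<open>G\<close> is
    carried along, downwards from the top.\<close>
  have "subgroup A G \<and> (A, B) \<in> (residual_step F G)\<^sup>*"
    if "(A, B) \<in> (maximal_step F G)\<^sup>*" "subgroup B G" for A B
    using that
  proof (induction rule: converse_rtrancl_induct)
    case base
    then show ?case by simp
  next
    case (step A C)
    then have C: "subgroup C G" "(C, B) \<in> (residual_step F G)\<^sup>*" by simp_all
    obtain X f where X: "subgroup A G" "A \<subseteq> C" "X \<in> F" "finite_group_epi (G\<lparr>carrier := C\<rparr>) X f"
      "\<And>x. x \<in> C \<Longrightarrow> f x = \<one>\<^bsub>X\<^esub> \<Longrightarrow> x \<in> A"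
      using maximal_step_epi[OF F(1,3) G C(1) step.hyps(1)] by metis
    have "(A, C) \<in> residual_step F G"
      by (rule residual_stepI[OF X(1) C(1) X(2,3) finite_group_epi.axioms(1)[OF X(4)] X(5)])
    then show ?case
      using C(2) X(1) by (simp add: converse_rtrancl_into_rtrancl)
  qed
  moreover have "(A, B) \<in> (maximal_step F G)\<^sup>*" if "(A, B) \<in> (residual_step F G)\<^sup>*" for A B
    using that
  proof induction
    case (step B C)
    then show ?case using residual_step_refine[OF F G] rtrancl_trans by metis
  qed simp
  ultimately show ?thesis
    using subgroup_self unfolding subnormal_wrt_iff_maximal_steps by blast
qed

text \<open>Applying \<open>in_class_FactGroup_iff\<close> to the class \<open>U\<close> of all
  finite groups moves an arbitrary quotient to a carrier of naturals.\<close>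

lemma nat_quotient:
  assumes "group G" "finite (carrier G)" "N \<lhd> G"
  obtains H :: "nat monoid" and h where "finite_group_epi G H h" "kernel G H h = N"
proof -
  define U :: group_class where "U = {H. group H \<and> finite (carrier H)}"
  have U: "group_class U"
    unfolding U_def group_class_def
    by (auto simp: is_iso_def iso_def) (metis bij_betw_finite)
  have "group (G Mod N)" "finite (carrier (G Mod N))"
    using assms normal.factorgroup_is_group by (auto simp: carrier_FactGroup)
  moreover from finite_group_iso_nat[OF this] obtain H :: "nat monoid" where "group H" "G Mod N \<cong> H"
    by blast
  ultimately have "in_class (G Mod N) U"
    unfolding in_class_def U_def is_iso_def iso_def by (auto simp: bij_betw_finite)
  then show thesis
    using in_class_FactGroup_iff[OF assms(1,2) U assms(3)] that by blast
qed

section \<open>Closure properties and idempotency of \<open>wstar\<close>\<close>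

context
  fixes F :: group_class
  assumes formation: "formation F" and hereditary: "hereditary F" and nonempty: "F \<noteq> {}"
begin

lemma wstar_iff:
  "G \<in> wstar \<pi> F \<longleftrightarrow> group G \<and> finite (carrier G) \<and> group_primes G \<subseteq> class_primes F \<and>
    (\<forall>q \<in> \<pi> \<inter> group_primes G. \<forall>Q. sylow_subgroup q Q G \<longrightarrow>
      (normalizer G Q, carrier G) \<in> (residual_step F G)\<^sup>*)"
proof (cases "group G \<and> finite (carrier G)")
  case True
  then have "subnormal_wrt F (normalizer G Q) G \<longleftrightarrow>
      (normalizer G Q, carrier G) \<in> (residual_step F G)\<^sup>*" if "sylow_subgroup q Q G" for q Q
    using subnormal_wrt_iff[OF formation hereditary nonempty] group.subgroup_normalizer[of G Q] that
    by (simp add: sylow_subgroup_def)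
  with True show ?thesis by (auto simp: wstar_def)
next
  case False
  then show ?thesis by (auto simp: wstar_def)
qed

text \<open>Primes not dividing the order are included: their Sylow subgroups are trivial, with the
  whole group as normalizer. This lets groups with different prime divisors be compared
  uniformly.\<close>

lemma wstar_normalizer:
  assumes G: "G \<in> wstar \<pi> F" and q: "q \<in> \<pi>" "prime q" and Q: "sylow_subgroup q Q G"
  shows "(normalizer G Q, carrier G) \<in> (residual_step F G)\<^sup>*"
proof (cases "q dvd order G")
  case True
  then show ?thesis using assms by (simp add: wstar_iff group_primes_def)
next
  case False
  interpret group G using G by (simp add: wstar_def)
  have fin: "finite (carrier G)" using G by (simp add: wstar_def)
  have Q': "subgroup Q G" "card Q = 1"
    using Q not_dvd_imp_multiplicity_0[OF False] by (simp_all add: sylow_subgroup_def)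
  then have "Q = {\<one>\<^bsub>G\<^esub>}"
    using subgroup.one_closed[OF Q'(1)] by (auto simp: card_1_singleton_iff)
  then have "x \<in> normalizer G Q \<longleftrightarrow> x \<in> carrier G" for x
    using mem_normalizer_iff[OF fin Q'(1), of x] by (simp cong: conj_cong)
  then have "normalizer G Q = carrier G" by blast
  then show ?thesis by simp
qed

text \<open>A Sylow subgroup of \<open>H\<close> lifts to a Sylow subgroup \<open>P\<close> of
  \<open>G\<close>, and the chain above the normalizer of \<open>P\<close> maps to one above the
  normalizer of its image.\<close>

lemma wstar_epi:
  fixes G H :: "nat monoid"
  assumes "finite_group_epi G H h" "G \<in> wstar \<pi> F" "\<pi> \<subseteq> all_primes"
  shows "H \<in> wstar \<pi> F"
proof -
  interpret finite_group_epi G H h by fact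
  have primes: "group_primes H \<subseteq> group_primes G"
    using order_dvd dvd_trans by (auto simp: group_primes_def)
  have "(normalizer H Q, carrier H) \<in> (residual_step F H)\<^sup>*"
    if q: "q \<in> \<pi> \<inter> group_primes H" and Q: "sylow_subgroup q Q H" for q Q
  proof -
    have pq: "prime q" "q \<in> \<pi>" using q by (simp_all add: group_primes_def)
    obtain P where P: "sylow_subgroup q P G" "h ` P = Q"
      using sylow_lift[OF pq(1) Q] by metis
    have "(h ` normalizer G P, h ` carrier G) \<in> (residual_step F H)\<^sup>*"
      by (rule rtrancl_image[OF wstar_normalizer[OF assms(2) pq(2,1) P(1)]])
        (rule residual_step_image[OF formation hereditary finite_G])
    then show ?thesis
      using normalizer_sylow_image[OF pq(1) P(1)] P(2) surj by simp
  qed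
  then show ?thesis
    using primes assms(2) H.is_group finite_H unfolding wstar_iff by blast
qed

text \<open>This is the heart of the second formation axiom: \<open>f1\<close> and \<open>f2\<close>
  together embed \<open>G\<close> into the product of \<open>H1\<close> and
  \<open>H2\<close>.\<close>

lemma wstar_subdirect:
  fixes G H1 H2 :: "nat monoid"
  assumes f: "finite_group_epi G H1 f1" "finite_group_epi G H2 f2"
    and ker: "\<And>x. x \<in> carrier G \<Longrightarrow> f1 x = \<one>\<^bsub>H1\<^esub> \<Longrightarrow> f2 x = \<one>\<^bsub>H2\<^esub> \<Longrightarrow> x = \<one>\<^bsub>G\<^esub>"
    and W: "H1 \<in> wstar \<pi> F" "H2 \<in> wstar \<pi> F" and \<pi>: "\<pi> \<subseteq> all_primes"
  shows "G \<in> wstar \<pi> F"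
proof -
  interpret f1: finite_group_epi G H1 f1 by fact
  interpret f2: finite_group_epi G H2 f2 by fact
  have fin: "finite (carrier G)" by (rule f1.finite_G)
  \<comment> \<open>On the part of \<open>K\<close> in the kernel of \<open>f1\<close>, the map
    \<open>f2\<close> is injective, so \<open>card K\<close> is a product of orders of subgroups of
    \<open>H1\<close> and \<open>H2\<close>.\<close>
  have card_eq: "card (f1 ` K) * card (f2 ` {x \<in> K. f1 x = \<one>\<^bsub>H1\<^esub>}) = card K"
    and sub: "subgroup {x \<in> K. f1 x = \<one>\<^bsub>H1\<^esub>} G"
    if K: "subgroup K G" for K
  proof -
    let ?T = "{x \<in> K. f1 x = \<one>\<^bsub>H1\<^esub>}"
    have sK: "K \<subseteq> carrier G" by (rule subgroup.subset[OF K])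
    have "?T = K \<inter> kernel G H1 f1" using sK by (auto simp: kernel_def)
    then show T: "subgroup ?T G"
      using f1.G.subgroups_Inter_pair[OF K f1.subgroup_kernel] by simp
    have "{x \<in> ?T. f2 x = \<one>\<^bsub>H2\<^esub>} = {\<one>\<^bsub>G\<^esub>}"
      using ker sK subgroup.one_closed[OF K] f1.hom_one f2.hom_one by blast
    then have "card (f2 ` ?T) = card ?T"
      using f2.card_image_mult_kernel[OF T] by simp
    then show "card (f1 ` K) * card (f2 ` ?T) = card K"
      using f1.card_image_mult_kernel[OF K] by simp
  qed
  have "q \<in> group_primes H1 \<union> group_primes H2" if q: "q \<in> group_primes G" for q
  proof -
    have "prime q" "q dvd order H1 * card (f2 ` {x \<in> carrier G. f1 x = \<one>\<^bsub>H1\<^esub>})"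
      using q card_eq[OF f1.G.subgroup_self] f1.surj by (simp_all add: group_primes_def order_def)
    moreover have "card (f2 ` {x \<in> carrier G. f1 x = \<one>\<^bsub>H1\<^esub>}) dvd order H2"
      by (rule f2.H.card_subgroup_dvd[OF f2.subgroup_img_is_subgroup[OF sub[OF f1.G.subgroup_self]]])
    ultimately show ?thesis
      by (auto simp: group_primes_def prime_dvd_mult_iff intro: dvd_trans)
  qed
  moreover have "group_primes H1 \<subseteq> class_primes F" "group_primes H2 \<subseteq> class_primes F"
    using W by (simp_all add: wstar_def)
  ultimately have primes: "group_primes G \<subseteq> class_primes F" by blast
  have "(normalizer G Q, carrier G) \<in> (residual_step F G)\<^sup>*"
    if q: "q \<in> \<pi>" "prime q" and Q: "sylow_subgroup q Q G" for q Q
  proof -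
    have Q': "subgroup Q G" "card Q = q ^ multiplicity q (order G)"
      using Q by (simp_all add: sylow_subgroup_def)
    have sQ: "Q \<subseteq> carrier G" by (rule subgroup.subset[OF Q'(1)])
    have fQ1: "subgroup (f1 ` Q) H1" and fQ2: "subgroup (f2 ` Q) H2"
      using f1.subgroup_img_is_subgroup[OF Q'(1)] f2.subgroup_img_is_subgroup[OF Q'(1)] .
    define M1 where "M1 = {x \<in> carrier G. f1 x \<in> normalizer H1 (f1 ` Q)}"
    define M2 where "M2 = {x \<in> carrier G. f2 x \<in> normalizer H2 (f2 ` Q)}"
    have M1: "subgroup M1 G" and M2: "subgroup M2 G"
      unfolding M1_def M2_def
      using f1.subgroup_vimage[OF f1.H.subgroup_normalizer[OF fQ1]]
        f2.subgroup_vimage[OF f2.H.subgroup_normalizer[OF fQ2]] .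
    have steps1: "(M1, carrier G) \<in> (residual_step F G)\<^sup>*"
      using rtrancl_image[where f = "\<lambda>S. {x \<in> carrier G. f1 x \<in> S}",
          OF wstar_normalizer[OF W(1) q f1.sylow_image[OF q(2) Q]] f1.residual_step_vimage]
        f1.vimage_carrier by (simp add: M1_def)
    have steps2: "(M2, carrier G) \<in> (residual_step F G)\<^sup>*"
      using rtrancl_image[where f = "\<lambda>S. {x \<in> carrier G. f2 x \<in> S}",
          OF wstar_normalizer[OF W(2) q f2.sylow_image[OF q(2) Q]] f2.residual_step_vimage]
        f2.vimage_carrier by (simp add: M2_def)
    \<comment> \<open>\<open>K\<close> consists of the elements that both maps send into the image
      of \<open>Q\<close>. Its order is a product of two powers of \<open>q\<close>, so it is a
      q-group containing the Sylow subgroup \<open>Q\<close> and equals it. Membership in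
      \<open>Q\<close> can therefore be tested in the two factors.\<close>
    define K where "K = {x \<in> carrier G. f1 x \<in> f1 ` Q} \<inter> {x \<in> carrier G. f2 x \<in> f2 ` Q}"
    have K: "subgroup K G"
      unfolding K_def by (rule f1.G.subgroups_Inter_pair[OF f1.subgroup_vimage[OF fQ1] f2.subgroup_vimage[OF fQ2]])
    let ?T = "{x \<in> K. f1 x = \<one>\<^bsub>H1\<^esub>}"
    have QK: "Q \<subseteq> K" using sQ by (auto simp: K_def)
    then have "f1 ` K = f1 ` Q" by (auto simp: K_def)
    then have "card (f1 ` K) dvd q ^ multiplicity q (order G)"
      using f1.card_image_mult_kernel[OF Q'(1)] Q'(2) by (metis dvd_triv_left)
    then obtain i where i: "card (f1 ` K) = q ^ i" using q(2) divides_primepow_nat by blast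
    have "f2 ` ?T \<subseteq> f2 ` Q" by (auto simp: K_def)
    then have "subgroup (f2 ` ?T) (H2\<lparr>carrier := f2 ` Q\<rparr>)"
      by (rule f2.H.subgroup_incl[OF f2.subgroup_img_is_subgroup[OF sub[OF K]] fQ2])
    from group.card_subgroup_dvd[OF f2.H.subgroup_imp_group[OF fQ2] this]
    have "card (f2 ` ?T) dvd card (f2 ` Q)" by (simp add: order_def)
    moreover have "card (f2 ` Q) dvd q ^ multiplicity q (order G)"
      using f2.card_image_mult_kernel[OF Q'(1)] Q'(2) by (metis dvd_triv_left)
    ultimately have "card (f2 ` ?T) dvd q ^ multiplicity q (order G)" by (rule dvd_trans)
    then obtain j where "card (f2 ` ?T) = q ^ j" using q(2) divides_primepow_nat by blast
    then have cK: "card K = q ^ (i + j)" using card_eq[OF K] i by (simp add: power_add)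
    have finK: "finite K" using subgroup.subset[OF K] fin finite_subset by blast
    then have "card Q \<le> card K" by (rule card_mono[OF _ QK])
    then have "multiplicity q (order G) \<le> i + j"
      using cK Q'(2) q(2) prime_gt_1_nat power_le_imp_le_exp by metis
    from f1.G.sylow_subgroupI[OF fin q(2) K cK this] have "card K = card Q"
      using Q'(2) by (simp add: sylow_subgroup_def)
    with finK QK have KQ: "K = Q" by (metis card_subset_eq)
    have "normalizer G Q = M1 \<inter> M2"
    proof (intro equalityI subsetI)
      fix x assume "x \<in> normalizer G Q"
      then have x: "x \<in> carrier G" "\<And>p. p \<in> Q \<Longrightarrow> x \<otimes>\<^bsub>G\<^esub> p \<otimes>\<^bsub>G\<^esub> inv\<^bsub>G\<^esub> x \<in> Q"
        by (simp_all add: f1.G.mem_normalizer_iff[OF fin Q'(1)])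
      have "f1 x \<in> f1 ` normalizer G Q" "f2 x \<in> f2 ` normalizer G Q"
        using \<open>x \<in> normalizer G Q\<close> by simp_all
      then show "x \<in> M1 \<inter> M2"
        using x(1) f1.normalizer_sylow_image[OF q(2) Q] f2.normalizer_sylow_image[OF q(2) Q]
        by (simp add: M1_def M2_def)
    next
      fix x assume "x \<in> M1 \<inter> M2"
      then have x: "x \<in> carrier G" "f1 x \<in> normalizer H1 (f1 ` Q)" "f2 x \<in> normalizer H2 (f2 ` Q)"
        by (simp_all add: M1_def M2_def)
      have "x \<otimes>\<^bsub>G\<^esub> p \<otimes>\<^bsub>G\<^esub> inv\<^bsub>G\<^esub> x \<in> K" if p: "p \<in> Q" for p
      proof -
        have pc: "p \<in> carrier G" using p sQ by blast
        have "f1 (x \<otimes>\<^bsub>G\<^esub> p \<otimes>\<^bsub>G\<^esub> inv\<^bsub>G\<^esub> x) \<in> f1 ` Q"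
          using x p pc by (simp add: f1.H.mem_normalizer_iff[OF f1.finite_H fQ1])
        moreover have "f2 (x \<otimes>\<^bsub>G\<^esub> p \<otimes>\<^bsub>G\<^esub> inv\<^bsub>G\<^esub> x) \<in> f2 ` Q"
          using x p pc by (simp add: f2.H.mem_normalizer_iff[OF f2.finite_H fQ2])
        ultimately show ?thesis using x(1) pc by (simp add: K_def)
      qed
      then show "x \<in> normalizer G Q"
        using x(1) by (simp add: KQ f1.G.mem_normalizer_iff[OF fin Q'(1)])
    qed
    then show ?thesis
      using f1.G.residual_step_Int[OF M1 M2 steps1 steps2] by simp
  qed
  then show ?thesis
    unfolding wstar_iff using fin f1.G.is_group primes unfolding group_primes_def by blast
qed

text \<open>The identity map of \<open>G\<close> goes into a member of \<open>F\<close> and has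
  trivial kernel, so every subgroup is one residual step below \<open>G\<close>.\<close>

lemma subset_wstar: "F \<subseteq> wstar \<pi> F"
proof
  fix G assume G: "G \<in> F"
  note gG = group_classD[OF formation_group_class[OF formation] G]
  interpret group G by fact
  have "group_hom G G (\<lambda>x. x)"
    by (simp add: group_hom_def group_hom_axioms_def hom_def is_group)
  then have "(A, carrier G) \<in> residual_step F G" if "subgroup A G" for A
    using that subgroup.one_closed[OF that]
    by (intro residual_stepI[OF that subgroup_self subgroup.subset[OF that] G]) auto
  then show "G \<in> wstar \<pi> F"
    using G gG subgroup_normalizer unfolding wstar_iff class_primes_def
    by (auto simp: sylow_subgroup_def)
qed

lemma group_class_wstar:
  assumes "\<pi> \<subseteq> all_primes"
  shows "group_class (wstar \<pi> F)"
  unfolding group_class_def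
proof (intro conjI ballI allI impI)
  fix G H :: "nat monoid"
  assume G: "G \<in> wstar \<pi> F" and H: "group H" "G \<cong> H"
  then obtain h where h: "h \<in> iso G H" by (auto simp: is_iso_def)
  have "finite_group_epi G H h"
    using G H(1) h by (intro finite_group_epiI)
      (simp_all add: wstar_def iso_def bij_betw_def group_hom_def group_hom_axioms_def)
  then show "H \<in> wstar \<pi> F" using wstar_epi G assms by blast
qed (simp_all add: wstar_def)

lemma formation_wstar:
  assumes \<pi>: "\<pi> \<subseteq> all_primes"
  shows "formation (wstar \<pi> F)"
  unfolding formation_def
proof (intro conjI ballI allI impI)
  note cW = group_class_wstar[OF \<pi>]
  show "group_class (wstar \<pi> F)" by (rule cW)
  fix G :: "nat monoid"
  {
    fix N assume G: "G \<in> wstar \<pi> F" and N: "N \<lhd> G"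
    note gG = group_classD[OF cW G]
    obtain H :: "nat monoid" and h where H: "finite_group_epi G H h" "kernel G H h = N"
      by (rule nat_quotient[OF gG N])
    moreover have "H \<in> wstar \<pi> F" by (rule wstar_epi[OF H(1) G \<pi>])
    ultimately show "in_class (G Mod N) (wstar \<pi> F)"
      using in_class_FactGroup_iff[OF gG cW N] by blast
  }
  fix N1 N2
  assume gG: "group G" "finite (carrier G)" and N: "N1 \<lhd> G" "N2 \<lhd> G"
    and "in_class (G Mod N1) (wstar \<pi> F)" "in_class (G Mod N2) (wstar \<pi> F)"
  then obtain H1 f1 H2 f2 where 1: "H1 \<in> wstar \<pi> F" "finite_group_epi G H1 f1" "kernel G H1 f1 = N1"
    and 2: "H2 \<in> wstar \<pi> F" "finite_group_epi G H2 f2" "kernel G H2 f2 = N2"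
    unfolding in_class_FactGroup_iff[OF gG cW N(1)] in_class_FactGroup_iff[OF gG cW N(2)] by blast
  interpret f1: finite_group_epi G H1 f1 by fact
  interpret f2: finite_group_epi G H2 f2 by fact
  have N12: "N1 \<inter> N2 \<lhd> G" by (rule f1.G.normal_subgroup_intersect[OF N])
  obtain H :: "nat monoid" and h where H: "finite_group_epi G H h" "kernel G H h = N1 \<inter> N2"
    by (rule nat_quotient[OF gG N12])
  interpret h: finite_group_epi G H h by fact
  have ker: "f1 x = \<one>\<^bsub>H1\<^esub> \<and> f2 x = \<one>\<^bsub>H2\<^esub> \<longleftrightarrow> h x = \<one>\<^bsub>H\<^esub>" if "x \<in> carrier G" for x
    using that 1(3) 2(3) H(2) by (auto simp: kernel_def set_eq_iff)
  \<comment> \<open>The kernel of \<open>h\<close> is the intersection of the kernels of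
    \<open>f1\<close> and \<open>f2\<close>, so both factor through \<open>h\<close>, and the
    factors \<open>g1\<close> and \<open>g2\<close> have trivial common kernel. Thus
    \<open>wstar_subdirect\<close> applies to \<open>H\<close>.\<close>
  obtain g1 where g1: "group_hom H H1 g1" "\<And>x. x \<in> carrier G \<Longrightarrow> g1 (h x) = f1 x"
    using h.factor_hom[OF f1.group_hom_axioms] ker by metis
  obtain g2 where g2: "group_hom H H2 g2" "\<And>x. x \<in> carrier G \<Longrightarrow> g2 (h x) = f2 x"
    using h.factor_hom[OF f2.group_hom_axioms] ker by metis
  have "g1 ` carrier H = carrier H1" "g2 ` carrier H = carrier H2"
    unfolding h.surj[symmetric] f1.surj[symmetric] f2.surj[symmetric] image_image
    using g1(2) g2(2) by simp_all
  then have "finite_group_epi H H1 g1" "finite_group_epi H H2 g2"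
    using g1(1) g2(1) h.finite_H by (simp_all add: finite_group_epiI)
  moreover have "y = \<one>\<^bsub>H\<^esub>" if y: "y \<in> carrier H" "g1 y = \<one>\<^bsub>H1\<^esub>" "g2 y = \<one>\<^bsub>H2\<^esub>" for y
  proof -
    obtain x where x: "x \<in> carrier G" "y = h x"
      using y(1) h.surj by blast
    then show ?thesis
      using y(2,3) g1(2)[OF x(1)] g2(2)[OF x(1)] ker[OF x(1)] by simp
  qed
  ultimately have "H \<in> wstar \<pi> F"
    by (rule wstar_subdirect[OF _ _ _ 1(1) 2(1) \<pi>])
  then show "in_class (G Mod (N1 \<inter> N2)) (wstar \<pi> F)"
    using in_class_FactGroup_iff[OF gG cW N12] H by blast
qed

text \<open>If \<open>q\<close> divides \<open>card H\<close>, it does not divide the index, so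
  Sylow q-subgroups of \<open>H\<close> are Sylow in \<open>G\<close>. Intersecting the chain of the
  normalizer with \<open>H\<close> gives the chain for the normalizer in \<open>H\<close>.\<close>

lemma S_H_closed_wstar: "S_H_closed (wstar \<pi> F)"
  unfolding S_H_closed_def
proof (intro ballI allI impI)
  fix G H assume G: "G \<in> wstar \<pi> F" and hall: "hall_subgroup H G"
  interpret group G using G by (simp add: wstar_def)
  have fin: "finite (carrier G)" using G by (simp add: wstar_def)
  have H: "subgroup H G" "coprime (card H) (card (rcosets\<^bsub>G\<^esub> H))"
    using hall by (simp_all add: hall_subgroup_def)
  let ?H = "G\<lparr>carrier := H\<rparr>"
  have finH: "finite H" using subgroup.subset[OF H(1)] fin finite_subset by blast
  have "group_primes ?H \<subseteq> group_primes G"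
    using card_subgroup_dvd[OF H(1)] dvd_trans by (auto simp: group_primes_def order_def)
  moreover have "(normalizer ?H Q, carrier ?H) \<in> (residual_step F ?H)\<^sup>*"
    if q: "q \<in> \<pi>" "prime q" "q dvd card H" and Q: "sylow_subgroup q Q ?H" for q Q
  proof -
    have "\<not> q dvd card (rcosets\<^bsub>G\<^esub> H)"
      using H(2) q(2,3) by (meson coprime_common_divisor not_prime_unit)
    moreover have "card (rcosets\<^bsub>G\<^esub> H) * card H = order G" by (rule lagrange[OF H(1)])
    ultimately have "multiplicity q (order G) = multiplicity q (card H)"
      using q(2) by (metis multiplicity_prime_elem_times_other mult.commute prime_imp_prime_elem)
    moreover have Q': "subgroup Q ?H" "card Q = q ^ multiplicity q (card H)"
      using Q by (simp_all add: sylow_subgroup_def order_def)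
    moreover have QG: "subgroup Q G" by (rule incl_subgroup[OF H(1) Q'(1)])
    ultimately have "sylow_subgroup q Q G" by (simp add: sylow_subgroup_def)
    from residual_steps_restrict[OF H(1) wstar_normalizer[OF G q(1,2) this]]
    have "(normalizer G Q \<inter> H, H) \<in> (residual_step F G)\<^sup>*"
      using subgroup.subset[OF H(1)] by (simp add: Int_absorb1)
    moreover have "Q \<subseteq> H" using subgroup.subset[OF Q'(1)] by simp
    ultimately show ?thesis
      using normalizer_restrict[OF fin QG H(1)] residual_steps_subgroup_iff[OF H(1) order_refl]
      by simp
  qed
  ultimately show "?H \<in> wstar \<pi> F"
    using G subgroup_imp_group[OF H(1)] finH unfolding wstar_iff
    by (auto simp: group_primes_def order_def)
qed

text \<open>One inclusion comes from \<open>subset_wstar\<close>, the other is built into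
  \<open>wstar\<close>. It matches the prime conditions of the two sides in
  \<open>wstar_idem\<close>.\<close>

lemma class_primes_wstar: "class_primes (wstar \<pi> F) = class_primes F"
  using subset_wstar[of \<pi>] by (auto simp: class_primes_def wstar_def)

text \<open>For one inclusion, enlarging \<open>F\<close> to \<open>wstar \<pi> F\<close> shrinks
  residuals, so maximal chains for \<open>F\<close> remain chains for the larger class. For the
  other, heredity is assumed only of \<open>F\<close>, so chains for the larger class are kept in
  the form \<open>maximal_step\<close>.\<close>

lemma wstar_idem:
  assumes \<pi>: "\<pi> \<subseteq> all_primes"
  shows "wstar \<pi> (wstar \<pi> F) = wstar \<pi> F"
proof (intro equalityI subsetI)
  let ?W = "wstar \<pi> F"
  note W = formation_wstar[OF \<pi>]
  have nW: "?W \<noteq> {}" using nonempty subset_wstar by blast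
  fix G
  {
    assume G: "G \<in> ?W"
    interpret group G using G by (simp add: wstar_def)
    have fin: "finite (carrier G)" using G by (simp add: wstar_def)
    have res: "residual (G\<lparr>carrier := B\<rparr>) ?W \<subseteq> residual (G\<lparr>carrier := B\<rparr>) F" if B: "subgroup B G" for B
    proof -
      have gB: "group (G\<lparr>carrier := B\<rparr>)" "finite (carrier (G\<lparr>carrier := B\<rparr>))"
        using subgroup_imp_group[OF B] finite_subset[OF subgroup.subset[OF B] fin] by simp_all
      show ?thesis
        using residual_least(3)[OF W nW gB] residual_least(1,2)[OF formation nonempty gB] subset_wstar
        unfolding in_class_def by blast
    qed
    have "subnormal_wrt ?W A G" if "subnormal_wrt F A G" for A
    proof -
      have "(A, B) \<in> (maximal_step ?W G)\<^sup>* \<and> subgroup A G"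
        if "(A, B) \<in> (maximal_step F G)\<^sup>*" "subgroup B G" for A B
        using that
      proof (induction rule: converse_rtrancl_induct)
        case base
        then show ?case by simp
      next
        case (step A C)
        then have C: "(C, B) \<in> (maximal_step ?W G)\<^sup>*" "subgroup C G" by simp_all
        have m: "maximal_subgroup A (G\<lparr>carrier := C\<rparr>)" "residual (G\<lparr>carrier := C\<rparr>) F \<subseteq> A"
          using step.hyps(1) by (simp_all add: maximal_step_def)
        then have "(A, C) \<in> maximal_step ?W G"
          using res[OF C(2)] by (auto simp: maximal_step_def)
        moreover have "subgroup A G"
          using m(1) incl_subgroup[OF C(2)] by (simp add: maximal_subgroup_def)
        ultimately show ?case using C(1) by (simp add: converse_rtrancl_into_rtrancl)
      qed
      with that show ?thesis
        unfolding subnormal_wrt_iff_maximal_steps using subgroup_self by blast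
    qed
    then show "G \<in> wstar \<pi> ?W"
      using G class_primes_wstar[of \<pi>] unfolding wstar_def[of _ ?W] by (simp add: wstar_def)
  }
  assume G: "G \<in> wstar \<pi> ?W"
  interpret group G using G by (simp add: wstar_def)
  have fin: "finite (carrier G)" using G by (simp add: wstar_def)
  have "(normalizer G Q, carrier G) \<in> (residual_step F G)\<^sup>*"
    if q: "q \<in> \<pi>" "q \<in> group_primes G" and Q: "sylow_subgroup q Q G" for q Q
  proof -
    have pq: "prime q" using q(2) by (simp add: group_primes_def)
    have Q': "subgroup Q G" using Q by (simp add: sylow_subgroup_def)
    let ?N = "normalizer G Q"
    have QN: "Q \<subseteq> ?N" by (rule subset_normalizer[OF fin Q'])
    \<comment> \<open>The claim is an implication because a link shows its lower term to be a
      subgroup of \<open>G\<close> only from the same fact about the upper one.\<close>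
    have "subgroup B G \<Longrightarrow> (?N, B) \<in> (residual_step F G)\<^sup>*"
      if "(?N, B) \<in> (maximal_step ?W G)\<^sup>*" for B
      using that
    proof (induction rule: rtrancl_induct)
      case (step B C)
      note C = step.prems
      obtain X f where X: "subgroup B G" "B \<subseteq> C" "X \<in> ?W" "finite_group_epi (G\<lparr>carrier := C\<rparr>) X f"
        "\<And>x. x \<in> C \<Longrightarrow> f x = \<one>\<^bsub>X\<^esub> \<Longrightarrow> x \<in> B"
        using maximal_step_epi[OF W nW is_group fin C step.hyps(2)] by metis
      interpret f: finite_group_epi "G\<lparr>carrier := C\<rparr>" X f by fact
      have NB: "(?N, B) \<in> (residual_step F G)\<^sup>*" by (rule step.IH[OF X(1)])
      then have sub: "?N \<subseteq> B" by (rule residual_steps_subset)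
      then have QC: "Q \<subseteq> C" "?N \<subseteq> C" using QN X(2) by blast+
      have QsC: "sylow_subgroup q Q (G\<lparr>carrier := C\<rparr>)"
        by (rule sylow_restrict[OF fin pq Q C QC(1)])
      have nC: "normalizer (G\<lparr>carrier := C\<rparr>) Q = ?N"
        using normalizer_restrict[OF fin Q' C QC(1)] QC(2) by (simp add: Int_absorb2)
      have nX: "normalizer X (f ` Q) = f ` ?N"
        using f.normalizer_sylow_image[OF pq QsC] nC by simp
      \<comment> \<open>This is the preimage of the normalizer of the image of \<open>Q\<close> in
        \<open>X\<close>, that is, \<open>?N\<close> times the kernel of \<open>f\<close>. As
        \<open>X\<close> is in \<open>?W\<close>, preimages of its chain join \<open>M\<close> to
        \<open>C\<close> by steps for \<open>F\<close>.\<close>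
      define M where "M = {x \<in> C. f x \<in> f ` ?N}"
      have "(M, C) \<in> (residual_step F (G\<lparr>carrier := C\<rparr>))\<^sup>*"
        using rtrancl_image[where f = "\<lambda>S. {x \<in> carrier (G\<lparr>carrier := C\<rparr>). f x \<in> S}",
            OF wstar_normalizer[OF X(3) q(1) pq f.sylow_image[OF pq QsC]] f.residual_step_vimage]
          f.vimage_carrier by (simp add: M_def nX)
      then have MC: "(M, C) \<in> (residual_step F G)\<^sup>*"
        using residual_steps_subgroup_iff[OF C order_refl] by simp
      have sX: "subgroup (f ` ?N) X"
        using f.subgroup_img_is_subgroup subgroup_incl[OF subgroup_normalizer[OF Q'] C QC(2)] by simp
      have M: "subgroup M G"
        using incl_subgroup[OF C, of M] f.subgroup_vimage[OF sX] by (simp add: M_def)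
      have "?N \<subseteq> M" using QC(2) by (auto simp: M_def)
      \<comment> \<open>An element of \<open>M\<close> differs from one of \<open>?N\<close> by an
        element of the kernel of \<open>f\<close>, and both the kernel and \<open>?N\<close> lie in
        \<open>B\<close>.\<close>
      moreover have "M \<subseteq> B"
      proof
        fix x assume "x \<in> M"
        then obtain n where x: "x \<in> C" "n \<in> ?N" "f x = f n" by (auto simp: M_def)
        have nC: "n \<in> C" using x(2) QC(2) by blast
        have iC: "inv\<^bsub>G\<^esub> n \<in> C" by (rule subgroup.m_inv_closed[OF C nC])
        have xn: "x \<otimes>\<^bsub>G\<^esub> inv\<^bsub>G\<^esub> n \<in> C" by (rule subgroup.m_closed[OF C x(1) iC])
        have "f (x \<otimes>\<^bsub>G\<^esub> inv\<^bsub>G\<^esub> n) = f x \<otimes>\<^bsub>X\<^esub> f (inv\<^bsub>G\<^esub> n)"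
          using f.hom_mult x(1) iC by simp
        also have "f (inv\<^bsub>G\<^esub> n) = inv\<^bsub>X\<^esub> f n"
          using f.hom_inv[of n] nC m_inv_consistent[OF C nC] by simp
        finally have "f (x \<otimes>\<^bsub>G\<^esub> inv\<^bsub>G\<^esub> n) = \<one>\<^bsub>X\<^esub>" using x(3) f.hom_closed[of n] nC by simp
        then have "x \<otimes>\<^bsub>G\<^esub> inv\<^bsub>G\<^esub> n \<in> B" by (rule X(5)[OF xn])
        moreover have "n \<in> B" using x(2) sub by blast
        ultimately have "x \<otimes>\<^bsub>G\<^esub> inv\<^bsub>G\<^esub> n \<otimes>\<^bsub>G\<^esub> n \<in> B" by (rule subgroup.m_closed[OF X(1)])
        moreover have "x \<in> carrier G" "n \<in> carrier G"
          using x(1) nC subgroup.subset[OF C] by blast+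
        ultimately show "x \<in> B" by (simp add: m_assoc)
      qed
      ultimately have "(?N, M) \<in> (residual_step F G)\<^sup>*"
        using residual_steps_restrict[OF M NB] by (simp add: Int_absorb1 Int_absorb2)
      then show ?case using MC by (rule rtrancl_trans)
    qed simp
    moreover have "subnormal_wrt ?W ?N G"
      using G q Q by (simp add: wstar_def[of _ ?W])
    ultimately show ?thesis
      using subgroup_self unfolding subnormal_wrt_iff_maximal_steps by blast
  qed
  moreover have "group_primes G \<subseteq> class_primes F"
    using G class_primes_wstar[of \<pi>] by (simp add: wstar_def[of _ ?W])
  ultimately show "G \<in> ?W"
    unfolding wstar_iff using is_group fin by blast
qed

end

theorem theorem2p4:
  fixes F :: group_class and \<pi> :: "nat set"
  assumes "formation F" and "hereditary F" and "F \<noteq> {}"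
    and "\<pi> \<subseteq> all_primes"
  shows "(F \<subseteq> wstar all_primes F \<and> wstar all_primes F \<subseteq> wstar \<pi> F) \<and>
    (formation (wstar \<pi> F) \<and> S_H_closed (wstar \<pi> F)) \<and>
    wstar \<pi> F = wstar \<pi> (wstar \<pi> F)"
proof (intro conjI)
  show "wstar all_primes F \<subseteq> wstar \<pi> F"
    using assms(4) by (auto simp: wstar_def)
qed (simp_all add: assms subset_wstar formation_wstar S_H_closed_wstar wstar_idem)

end
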